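(* Let $C$ be a closed convex subset of a Banach space $X$. The following assertions are equivalent: (i) $C$ is weakly compact; (ii) every closed convex subset of $C$ is ergodic.
   Context: Let $D$ be a convex subset of a Banach space. An affine function $T:D\to D$ is ergodic if the sequence $\left(\frac1n\sum_{k=0}^{n-1}T^k(x)\right)_{n}$ converges in norm for every $x\in D$. It is Cesaro equicontinuous if the family $\left\{\frac1n\sum_{k=0}^{n-1}T^k\right\}_{n\ge1}$ is equicontinuous on $D$. The set $D$ is ergodic if every Cesaro equicontinuous affine function $T:D\to D$ is ergodic. *)

theory Defs
  imports "HOL-Analysis.Analysis"
begin

definition weak_topology :: "'a::real_normed_vector topology" where
  "weak_topology =
     topology_generated_by {f -` U | (f :: 'a \<Rightarrow> real) U. bounded_linear f \<and> open U}"

definition weakly_compact :: "'a::real_normed_vector set \<Rightarrow> bool" where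
  "weakly_compact C \<longleftrightarrow> compactin weak_topology C"

definition affine_fun_on :: "'a::real_vector set \<Rightarrow> ('a \<Rightarrow> 'b::real_vector) \<Rightarrow> bool" where
  "affine_fun_on D T \<longleftrightarrow>
     (\<forall>x\<in>D. \<forall>y\<in>D. \<forall>t\<in>{0..1}.
        T ((1 - t) *\<^sub>R x + t *\<^sub>R y) = (1 - t) *\<^sub>R T x + t *\<^sub>R T y)"

text \<open>
  A function from \<open>D\<close> to \<open>D\<close> is represented by a total function \<open>T\<close> with
  \<open>T \<in> D \<rightarrow> D\<close>; the notions below only depend on the values of \<open>T\<close> on \<open>D\<close>.
  The mean of index \<open>n = 0\<close> is the junk value \<open>0\<close>.
\<close>

definition cesaro_mean :: "('a::real_vector \<Rightarrow> 'a) \<Rightarrow> nat \<Rightarrow> 'a \<Rightarrow> 'a" where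
  "cesaro_mean T n x = (1 / real n) *\<^sub>R (\<Sum>k<n. (T ^^ k) x)"

text \<open>Equicontinuity is meant pointwise: the \<open>\<delta>\<close> may depend on the point \<open>x\<close>.\<close>

definition equicontinuous_on ::
    "'a::metric_space set \<Rightarrow> ('a \<Rightarrow> 'b::metric_space) set \<Rightarrow> bool" where
  "equicontinuous_on D \<F> \<longleftrightarrow>
     (\<forall>x\<in>D. \<forall>\<epsilon>>0. \<exists>\<delta>>0. \<forall>f\<in>\<F>. \<forall>y\<in>D. dist y x < \<delta> \<longrightarrow> dist (f y) (f x) < \<epsilon>)"

definition cesaro_equicontinuous ::
    "'a::real_normed_vector set \<Rightarrow> ('a \<Rightarrow> 'a) \<Rightarrow> bool" where
  "cesaro_equicontinuous D T \<longleftrightarrow> equicontinuous_on D {cesaro_mean T n | n. n \<ge> 1}"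

definition ergodic_fun ::
    "'a::real_normed_vector set \<Rightarrow> ('a \<Rightarrow> 'a) \<Rightarrow> bool" where
  "ergodic_fun D T \<longleftrightarrow> (\<forall>x\<in>D. convergent (\<lambda>n. cesaro_mean T n x))"

definition ergodic_set :: "'a::real_normed_vector set \<Rightarrow> bool" where
  "ergodic_set D \<longleftrightarrow>
     (\<forall>T. T \<in> D \<rightarrow> D \<and> affine_fun_on D T \<and> cesaro_equicontinuous D T \<longrightarrow> ergodic_fun D T)"

end

theory Submission
  imports Defs
begin

text \<open>
  If \<open>C\<close> is weakly compact, the closed convex hulls of the tails of the means of a point \<open>x\<close> have a
  common point.  It is fixed by \<open>T\<close>, and Cesaro equicontinuity at this fixed point forces the means
  of \<open>x\<close> to converge to it.

  If \<open>C\<close> is not weakly compact, then \<open>C\<close> contains a ray, on which a translation is not ergodic, or a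
  sequence \<open>x n\<close> whose differences \<open>d n = x (n + 1) - x n\<close> form a basic sequence bounded away from
  \<open>0\<close>.  For bounded \<open>C\<close> the points \<open>x n\<close> are chosen close, on finite norming sets of functionals, to
  a point of the weak-star closure of \<open>C\<close> in the bidual that lies outside the space.  For
  unbounded \<open>C\<close> all of whose bounded closed convex subsets are weakly compact, absence of rays allows
  one to move arbitrarily far without being noticed by finitely many functionals.  In both cases, on
  the closed convex hull of the \<open>x n\<close>, a point \<open>x 0 + (\<Sum>n. c n *\<^sub>R d n)\<close> is mapped to the point with the
  coefficients \<open>1 - F n * (1 - c n)\<close>, where \<open>F n < 1\<close> increases to \<open>1\<close> fast.  The powers of this map are
  uniformly Lipschitz by summation by parts, and the means drive every coefficient to \<open>1\<close>, which
  no point of the hull allows.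
\<close>

section \<open>Domination by sublinear functionals\<close>

text \<open>Differences make the hull visible in coordinates: convex combinations of the
  \<open>x n\<close> are the coefficient sequences 1 >= c 0 >= c 1 >= ... >= 0 that are eventually
  0. Points of the closure still have coefficients tending to 0, so the constant sequence 1 is the
  missing limit. The rule 1 - F n * (1 - c n) keeps sequences decreasing because F increases, and
  fixes only the constant 1 because F n < 1. Fast convergence of F to 1 makes the map the identity
  plus an absolutely convergent series, even when the lengths of the \<open>d n\<close> are
  unbounded. The obstacle is to keep the differences from collapsing. For bounded \<open>C\<close>,
  completeness gives the bidual point a positive distance from the space, and the finite sets of
  functionals must norm the span of the chosen points enlarged by the direction from the latest
  point to the bidual point. For unbounded \<open>C\<close> no limit point is at hand, and a
  difference is only required to look small relative to its own length.\<close>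

definition sublinear :: "('a::real_vector \<Rightarrow> real) \<Rightarrow> bool" where
  "sublinear q \<longleftrightarrow> (\<forall>x y. q (x + y) \<le> q x + q y) \<and> (\<forall>t\<ge>0. \<forall>x. q (t *\<^sub>R x) = t * q x)"

lemma sublinear_add: "sublinear q \<Longrightarrow> q (x + y) \<le> q x + q y"
  and sublinear_scale: "sublinear q \<Longrightarrow> 0 \<le> t \<Longrightarrow> q (t *\<^sub>R x) = t * q x"
  by (auto simp: sublinear_def)

lemma sublinear_zero: "sublinear q \<Longrightarrow> q 0 = 0"
  using sublinear_scale[of q 0 0] by simp

lemma sublinear_neg: "sublinear q \<Longrightarrow> - q (- x) \<le> q x"
  using sublinear_add[of q x "- x"] sublinear_zero[of q] by simp

lemma sublinearI:
  assumes "\<And>x y. q (x + y) \<le> q x + q y"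
    and "\<And>t x. 0 < t \<Longrightarrow> q (t *\<^sub>R x) \<le> t * q x" and "q 0 = 0"
  shows "sublinear q"
proof -
  have "q (t *\<^sub>R x) = t * q x" if t: "0 < t" for t x
  proof (rule antisym)
    show "q (t *\<^sub>R x) \<le> t * q x" using assms(2) t .
    have "q ((1/t) *\<^sub>R (t *\<^sub>R x)) \<le> (1/t) * q (t *\<^sub>R x)"
      by (rule assms(2)) (use t in simp)
    then show "t * q x \<le> q (t *\<^sub>R x)" using t by (simp add: field_simps)
  qed
  then show ?thesis
    unfolding sublinear_def using assms(1,3) by (metis less_eq_real_def mult_zero_left scaleR_zero_left)
qed

definition is_cone :: "('a::real_vector) set \<Rightarrow> bool" where
  "is_cone K \<longleftrightarrow> 0 \<in> K \<and> (\<forall>x\<in>K. \<forall>y\<in>K. x + y \<in> K) \<and> (\<forall>x\<in>K. \<forall>t>0. t *\<^sub>R x \<in> K)"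

text \<open>\<open>r x\<close> is the infimum of \<open>q (x + v) - s\<close> over
  \<open>(v, s)\<close> in \<open>K\<close>. Every linear \<open>f\<close> below \<open>r\<close>
  satisfies \<open>f v \<ge> s\<close> on \<open>K\<close>, so the constraints are absorbed into the
  sublinear bound before any linear functional is chosen.\<close>

lemma sublinear_lower:
  fixes q :: "'a::real_vector \<Rightarrow> real"
  assumes q: "sublinear q" and K: "is_cone K" and dom: "\<And>v s. (v, s) \<in> K \<Longrightarrow> s \<le> q v"
  obtains r where "sublinear r" "\<And>x. r x \<le> q x" "\<And>v s. (v, s) \<in> K \<Longrightarrow> r (- v) \<le> - s"
proof -
  define r where "r x = (INF k\<in>K. q (x + fst k) - snd k)" for x
  have bdd: "bdd_below ((\<lambda>k. q (x + fst k) - snd k) ` K)" for x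
  proof (rule bdd_belowI2[where m = "- q (- x)"])
    fix k assume k: "k \<in> K"
    have "q (- x + (x + fst k)) \<le> q (- x) + q (x + fst k)" by (rule sublinear_add[OF q])
    moreover have "snd k \<le> q (fst k)" using dom[of "fst k" "snd k"] k by simp
    ultimately show "- q (- x) \<le> q (x + fst k) - snd k" by simp
  qed
  have K0: "0 \<in> K" using K by (simp add: is_cone_def)
  have le: "r x \<le> q (x + fst k) - snd k" if "k \<in> K" for x k
    unfolding r_def by (rule cINF_lower[OF bdd that])
  have ge: "m \<le> r x" if "\<And>k. k \<in> K \<Longrightarrow> m \<le> q (x + fst k) - snd k" for m x
    unfolding r_def by (rule cINF_greatest) (use K0 that in auto)
  have "sublinear r"
  proof (rule sublinearI)
    fix x y
    have 1: "r (x + y) \<le> (q (x + fst k) - snd k) + (q (y + fst l) - snd l)" if "k \<in> K" "l \<in> K" for k l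
    proof -
      have "k + l \<in> K" using K that by (simp add: is_cone_def)
      from le[OF this, of "x + y"] have "r (x + y) \<le> q ((x + fst k) + (y + fst l)) - snd k - snd l"
        by (simp add: algebra_simps)
      with sublinear_add[OF q, of "x + fst k" "y + fst l"] show ?thesis by linarith
    qed
    have "r (x + y) - (q (y + fst l) - snd l) \<le> r x" if "l \<in> K" for l
      by (rule ge) (use 1 that in \<open>simp add: algebra_simps\<close>)
    then have "r (x + y) - r x \<le> r y" by (intro ge) (simp add: algebra_simps)
    then show "r (x + y) \<le> r x + r y" by simp
  next
    fix t :: real and x assume t: "0 < t"
    have "r (t *\<^sub>R x) / t \<le> r x"
    proof (rule ge)
      fix k assume "k \<in> K"
      then have "t *\<^sub>R k \<in> K" using K t by (simp add: is_cone_def)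
      from le[OF this, of "t *\<^sub>R x"] have "r (t *\<^sub>R x) \<le> q (t *\<^sub>R (x + fst k)) - t * snd k"
        by (simp add: algebra_simps)
      also have "\<dots> = t * (q (x + fst k) - snd k)"
        using sublinear_scale[OF q, of t "x + fst k"] t by (simp add: right_diff_distrib)
      finally show "r (t *\<^sub>R x) / t \<le> q (x + fst k) - snd k"
        using t by (simp add: field_simps)
    qed
    then show "r (t *\<^sub>R x) \<le> t * r x" using t by (simp add: field_simps)
  next
    show "r 0 = 0"
    proof (rule antisym)
      show "r 0 \<le> 0" using le[OF K0, of 0] sublinear_zero[OF q] by simp
      show "0 \<le> r 0" by (rule ge) (use dom in auto)
    qed
  qed
  moreover have "r x \<le> q x" for x using le[OF K0, of x] by simp
  moreover have "r (- v) \<le> - s" if "(v, s) \<in> K" for v s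
    using le[OF that, of "- v"] sublinear_zero[OF q] by simp
  ultimately show ?thesis using that by blast
qed

text \<open>Lowering \<open>q\<close> along the ray through \<open>y\<close> with the slope
  \<open>q y\<close> cannot change a minimal \<open>q\<close>. This gives
  \<open>q (- y) \<le> - q y\<close>, hence oddness, and an odd subadditive function is
  additive.\<close>

lemma minimal_sublinear_linear:
  fixes q :: "'a::real_vector \<Rightarrow> real"
  assumes q: "sublinear q" and min: "\<And>r. sublinear r \<Longrightarrow> (\<And>x. r x \<le> q x) \<Longrightarrow> r = q"
  shows "linear q"
proof -
  have neg: "q (- y) = - q y" for y
  proof -
    let ?K = "{(t *\<^sub>R y, t * q y) | t. 0 \<le> t}"
    have "is_cone ?K"
      unfolding is_cone_def
    proof (intro conjI ballI allI impI)
      show "0 \<in> ?K" by (auto simp: zero_prod_def intro!: exI[of _ 0])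
    next
      fix a b assume "a \<in> ?K" "b \<in> ?K"
      then obtain s t where "a = (s *\<^sub>R y, s * q y)" "b = (t *\<^sub>R y, t * q y)" "0 \<le> s" "0 \<le> t" by blast
      then show "a + b \<in> ?K" by (auto intro!: exI[of _ "s + t"] simp: algebra_simps)
    next
      fix a and t :: real assume "a \<in> ?K" "0 < t"
      then obtain s where "a = (s *\<^sub>R y, s * q y)" "0 \<le> s" by blast
      with \<open>0 < t\<close> show "t *\<^sub>R a \<in> ?K" by (auto intro!: exI[of _ "t * s"])
    qed
    moreover have "s \<le> q v" if "(v, s) \<in> ?K" for v s
      using that sublinear_scale[OF q] by auto
    ultimately obtain r where r: "sublinear r" "\<And>x. r x \<le> q x" "\<And>v s. (v, s) \<in> ?K \<Longrightarrow> r (- v) \<le> - s"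
      using sublinear_lower[OF q] by blast
    have "(y, q y) \<in> ?K" by (auto intro!: exI[of _ 1])
    from r(3)[OF this] min[OF r(1,2)] have "q (- y) \<le> - q y" by simp
    with sublinear_neg[OF q, of "- y"] show ?thesis by simp
  qed
  show ?thesis
  proof (rule linearI)
    fix x y
    have "q (- x + - y) \<le> q (- x) + q (- y)" by (rule sublinear_add[OF q])
    with neg have "q x + q y \<le> q (x + y)" using neg[of "x + y"] by simp
    with sublinear_add[OF q, of x y] show "q (x + y) = q x + q y" by simp
  next
    fix c x
    show "q (c *\<^sub>R x) = c *\<^sub>R q x"
    proof (cases "0 \<le> c")
      case False
      have "q (c *\<^sub>R x) = q (- ((- c) *\<^sub>R x))" by simp
      also have "\<dots> = - ((- c) * q x)"
        unfolding neg using False by (subst sublinear_scale[OF q]) auto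
      finally show ?thesis by simp
    qed (simp add: sublinear_scale[OF q])
  qed
qed

text \<open>Zorn's lemma, ordered so that smaller functionals count as larger. A chain has a finite
  pointwise infimum because every \<open>q\<close> below \<open>p\<close> satisfies
  \<open>q x \<ge> - p (- x)\<close>; the infimum stays subadditive since of two members of the
  chain one lies below the other.\<close>

lemma hahn_banach_sublinear:
  fixes p :: "'a::real_vector \<Rightarrow> real"
  assumes p: "sublinear p"
  obtains f where "linear f" "\<And>x. f x \<le> p x"
proof -
  define A where "A = {q. sublinear q \<and> (\<forall>x. q x \<le> p x)}"
  define P where "P a b \<longleftrightarrow> (\<forall>x. b x \<le> a x)" for a b :: "'a \<Rightarrow> real"
  have "partial_order_on A (relation_of P A)"
    by (rule partial_order_on_relation_ofI) (auto simp: P_def fun_eq_iff intro: order_trans antisym)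
  moreover have "\<exists>u\<in>A. \<forall>a\<in>C. P a u" if C: "C \<in> Chains (relation_of P A)" for C
  proof (cases "C = {}")
    case True
    then show ?thesis using p by (auto simp: A_def)
  next
    case False
    have CA: "q \<in> A" if "q \<in> C" for q
      using C that by (auto simp: Chains_def relation_of_def)
    have tot: "P a b \<or> P b a" if "a \<in> C" "b \<in> C" for a b
      using C that by (auto simp: Chains_def relation_of_def)
    define u where "u x = (INF q\<in>C. q x)" for x
    have bdd: "bdd_below ((\<lambda>q. q x) ` C)" for x
    proof (rule bdd_belowI2[where m = "- p (- x)"])
      fix q assume "q \<in> C"
      from CA[OF this] have "sublinear q" "q (- x) \<le> p (- x)" by (auto simp: A_def)
      with sublinear_neg[of q x] show "- p (- x) \<le> q x" by simp
    qed
    have le: "u x \<le> q x" if "q \<in> C" for q x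
      unfolding u_def by (rule cINF_lower[OF bdd that])
    have ge: "m \<le> u x" if "\<And>q. q \<in> C \<Longrightarrow> m \<le> q x" for m x
      unfolding u_def by (rule cINF_greatest) (use False that in auto)
    have "sublinear u"
    proof (rule sublinearI)
      fix x y
      have 1: "u (x + y) \<le> a x + b y" if ab: "a \<in> C" "b \<in> C" for a b
      proof -
        obtain q where q: "q \<in> C" "q x \<le> a x" "q y \<le> b y"
          using tot[OF ab] ab by (auto simp: P_def)
        have "u (x + y) \<le> q (x + y)" by (rule le[OF q(1)])
        also have "\<dots> \<le> q x + q y" using CA[OF q(1)] by (auto simp: A_def sublinear_add)
        finally show ?thesis using q by simp
      qed
      have "u (x + y) - b y \<le> u x" if "b \<in> C" for b
        by (rule ge) (use 1 that in \<open>simp add: algebra_simps\<close>)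
      then have "u (x + y) - u x \<le> u y" by (intro ge) (simp add: algebra_simps)
      then show "u (x + y) \<le> u x + u y" by simp
    next
      fix t :: real and x assume t: "0 < t"
      have "u (t *\<^sub>R x) / t \<le> u x"
      proof (rule ge)
        fix q assume q: "q \<in> C"
        have "u (t *\<^sub>R x) \<le> q (t *\<^sub>R x)" by (rule le[OF q])
        also have "\<dots> = t * q x" using CA[OF q] t by (auto simp: A_def sublinear_scale)
        finally show "u (t *\<^sub>R x) / t \<le> q x" using t by (simp add: field_simps)
      qed
      then show "u (t *\<^sub>R x) \<le> t * u x" using t by (simp add: field_simps)
    next
      show "u 0 = 0"
      proof (rule antisym)
        obtain q where "q \<in> C" using False by blast
        then show "u 0 \<le> 0" using le[of q 0] CA[of q] by (auto simp: A_def sublinear_zero)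
        show "0 \<le> u 0" by (rule ge) (use CA in \<open>auto simp: A_def sublinear_zero\<close>)
      qed
    qed
    moreover have "u x \<le> p x" for x
    proof -
      obtain q where "q \<in> C" using False by blast
      then show ?thesis using le[of q x] CA[of q] by (auto simp: A_def intro: order_trans)
    qed
    ultimately show ?thesis using le by (auto simp: A_def P_def intro!: bexI[of _ u])
  qed
  ultimately obtain m where m: "m \<in> A" "\<And>a. a \<in> A \<Longrightarrow> P m a \<Longrightarrow> a = m"
    using predicate_Zorn[of A P] by blast
  have "linear m"
  proof (rule minimal_sublinear_linear)
    show "sublinear m" using m by (simp add: A_def)
    fix r assume r: "sublinear r" "\<And>x. r x \<le> m x"
    then have "r \<in> A" using m(1) by (auto simp: A_def intro: order_trans)
    then show "r = m" using m(2) r(2) by (auto simp: P_def)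
  qed
  then show ?thesis using that m(1) by (auto simp: A_def)
qed

text \<open>A pair \<open>(v, s)\<close> prescribes the lower bound \<open>s\<close> for
  \<open>g v\<close>. A ray of pairs yields norming functionals, the cone over a translated convex
  set yields separation, a subspace of pairs prescribes exact values.\<close>

lemma cone_domination:
  fixes K :: "('a::real_normed_vector \<times> real) set"
  assumes K: "is_cone K" and R: "0 \<le> R" and dom: "\<And>v s. (v, s) \<in> K \<Longrightarrow> s \<le> R * norm v"
  shows "\<exists>g :: 'a \<Rightarrow>\<^sub>L real. norm g \<le> R \<and> (\<forall>k\<in>K. snd k \<le> blinfun_apply g (fst k))"
proof -
  have "sublinear (\<lambda>x::'a. R * norm x)"
    by (rule sublinearI) (auto simp: R mult_left_mono norm_triangle_ineq simp flip: distrib_left)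
  then obtain r where r: "sublinear r" "\<And>x. r x \<le> R * norm x" "\<And>v s. (v, s) \<in> K \<Longrightarrow> r (- v) \<le> - s"
    using sublinear_lower[OF _ K, of "\<lambda>x. R * norm x"] dom by blast
  obtain f where f: "linear f" "\<And>x. f x \<le> r x"
    using hahn_banach_sublinear[OF r(1)] by blast
  interpret f: linear f by fact
  have le: "f x \<le> R * norm x" for x using f(2) r(2) order_trans by blast
  have bd: "norm (f x) \<le> norm x * R" for x
    using le[of x] le[of "- x"] by (simp add: f.neg abs_le_iff mult.commute)
  have bl: "bounded_linear f"
    by (rule bounded_linear_intro[where K = R]) (use bd in \<open>auto simp: f.add f.scale\<close>)
  have app: "blinfun_apply (Blinfun f) = f" by (rule bounded_linear_Blinfun_apply[OF bl])
  show ?thesis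
  proof (intro exI[of _ "Blinfun f"] conjI ballI)
    show "norm (Blinfun f) \<le> R"
      by (rule norm_blinfun_bound) (use R bd in \<open>auto simp: app mult.commute\<close>)
    fix k assume "k \<in> K"
    then have "f (- fst k) \<le> - snd k" using r(3)[of "fst k" "snd k"] f(2) order_trans by fastforce
    then show "snd k \<le> blinfun_apply (Blinfun f) (fst k)" by (simp add: app f.neg)
  qed
qed

section \<open>Functionals obtained from domination on a cone\<close>

lemma norming_functional:
  fixes x :: "'a::real_normed_vector"
  obtains g :: "'a \<Rightarrow>\<^sub>L real" where "norm g \<le> 1" "g x = norm x"
proof -
  let ?K = "{(t *\<^sub>R x, t * norm x) | t. 0 \<le> t}"
  have "is_cone ?K"
    unfolding is_cone_def
  proof (intro conjI ballI allI impI)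
    show "0 \<in> ?K" by (auto simp: zero_prod_def intro!: exI[of _ 0])
  next
    fix a b assume "a \<in> ?K" "b \<in> ?K"
    then obtain s t where "a = (s *\<^sub>R x, s * norm x)" "b = (t *\<^sub>R x, t * norm x)" "0 \<le> s" "0 \<le> t" by blast
    then show "a + b \<in> ?K" by (auto intro!: exI[of _ "s + t"] simp: algebra_simps)
  next
    fix a and t :: real assume "a \<in> ?K" "0 < t"
    then obtain s where "a = (s *\<^sub>R x, s * norm x)" "0 \<le> s" by blast
    with \<open>0 < t\<close> show "t *\<^sub>R a \<in> ?K" by (auto intro!: exI[of _ "t * s"])
  qed
  moreover have "s \<le> 1 * norm v" if "(v, s) \<in> ?K" for v s
    using that by auto
  ultimately obtain g :: "'a \<Rightarrow>\<^sub>L real" where g: "norm g \<le> 1" "\<forall>k\<in>?K. snd k \<le> blinfun_apply g (fst k)"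
    using cone_domination[OF _ zero_le_one, of ?K] by blast
  have "(x, norm x) \<in> ?K" by (auto intro!: exI[of _ 1])
  from bspec[OF g(2) this] have "norm x \<le> g x" by simp
  moreover have "g x \<le> norm x"
    using norm_blinfun[of g x] mult_right_mono[OF g(1), of "norm x"] by simp
  ultimately show ?thesis using that g(1) by force
qed

lemma separate_point_closed_convex:
  fixes C :: "'a::real_normed_vector set"
  assumes C: "closed C" "convex C" and x: "x \<notin> C"
  shows "\<exists>(g :: 'a \<Rightarrow>\<^sub>L real) r. 0 < r \<and> (\<forall>c\<in>C. g x + r \<le> g c)"
proof -
  have "open (- C)" using C by auto
  then obtain r where r: "0 < r" "ball x r \<subseteq> - C" using x openE by blast
  have far: "r \<le> norm (c - x)" if "c \<in> C" for c
    using r(2) that by (force simp: subset_eq dist_norm norm_minus_commute)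
  \<comment> \<open>The pairs demand \<open>g (c - x) \<ge> r\<close>, which never exceeds
    \<open>norm (c - x)\<close>. The alternative \<open>t = 0\<close> puts the origin into the cone
    even if \<open>C\<close> is empty.\<close>
  let ?K = "{(t *\<^sub>R (c - x), t * r) | t c. 0 \<le> t \<and> (t = 0 \<or> c \<in> C)}"
  have cone: "is_cone ?K"
    unfolding is_cone_def
  proof (intro conjI ballI allI impI)
    show "0 \<in> ?K" by (auto simp: zero_prod_def intro!: exI[of _ 0])
  next
    fix a b assume "a \<in> ?K" "b \<in> ?K"
    then obtain s t c e where a: "a = (s *\<^sub>R (c - x), s * r)" "0 \<le> s" "s = 0 \<or> c \<in> C"
      and b: "b = (t *\<^sub>R (e - x), t * r)" "0 \<le> t" "t = 0 \<or> e \<in> C" by blast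
    show "a + b \<in> ?K"
    proof (cases "s = 0 \<or> t = 0")
      case True
      then show ?thesis
      proof
        assume "s = 0"
        then have "a + b = (t *\<^sub>R (e - x), t * r)" using a b by (simp add: zero_prod_def)
        then show ?thesis using b by blast
      next
        assume "t = 0"
        then have "a + b = (s *\<^sub>R (c - x), s * r)" using a b by (simp add: zero_prod_def)
        then show ?thesis using a by blast
      qed
    next
      case False
      let ?c = "(s / (s + t)) *\<^sub>R c + (t / (s + t)) *\<^sub>R e"
      have pos: "0 < s + t" using False a b by auto
      have "?c \<in> C"
        using C(2) a b False pos unfolding convex_def
        by (auto simp: add_divide_distrib[symmetric])
      moreover have "(s + t) *\<^sub>R ?c = s *\<^sub>R c + t *\<^sub>R e"
        using pos by (simp add: scaleR_add_right)
      then have "(s + t) *\<^sub>R (?c - x) = s *\<^sub>R (c - x) + t *\<^sub>R (e - x)"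
        by (simp add: scaleR_right_diff_distrib scaleR_add_left)
      then have "a + b = ((s + t) *\<^sub>R (?c - x), (s + t) * r)" using a b by (simp add: algebra_simps)
      ultimately show ?thesis using pos by (intro CollectI exI[of _ "s + t"] exI[of _ ?c]) auto
    qed
  next
    fix a and t :: real assume "a \<in> ?K" "0 < t"
    then obtain s c where "a = (s *\<^sub>R (c - x), s * r)" "0 \<le> s" "s = 0 \<or> c \<in> C" by blast
    with \<open>0 < t\<close> show "t *\<^sub>R a \<in> ?K" by (intro CollectI exI[of _ "t * s"] exI[of _ c]) auto
  qed
  have dom: "s \<le> 1 * norm v" if "(v, s) \<in> ?K" for v s
    using that far by (auto intro!: mult_left_mono)
  have "\<exists>g :: 'a \<Rightarrow>\<^sub>L real. \<forall>k\<in>?K. snd k \<le> blinfun_apply g (fst k)"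
    using cone_domination[OF cone zero_le_one dom] by blast
  then obtain g :: "'a \<Rightarrow>\<^sub>L real" where g: "\<forall>k\<in>?K. snd k \<le> blinfun_apply g (fst k)" ..
  have "g x + r \<le> g c" if "c \<in> C" for c
  proof -
    have "(c - x, r) \<in> ?K" using that by (intro CollectI exI[of _ 1] exI[of _ c]) auto
    from bspec[OF g this] show ?thesis by (simp add: blinfun.diff_right)
  qed
  with r(1) show ?thesis by blast
qed

lemma in_span_range_natE:
  fixes d :: "nat \<Rightarrow> 'a::real_vector"
  assumes "x \<in> span (range d)"
  obtains N c where "x = (\<Sum>k<N. c k *\<^sub>R d k)"
proof -
  have "\<exists>N c. x = (\<Sum>k<N. c k *\<^sub>R d k)"
    using assms
  proof (induction rule: span_induct_alt)
    case base
    show ?case by (intro exI[of _ 0]) simp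
  next
    case (step a v y)
    then obtain i N c where y: "y = (\<Sum>k<N. c k *\<^sub>R d k)" and v: "v = d i" by blast
    let ?M = "max N (Suc i)"
    let ?c = "\<lambda>k. (if k < N then c k else 0) + (if k = i then a else 0)"
    have "(\<Sum>k<?M. (if k < N then c k else 0) *\<^sub>R d k) = (\<Sum>k<N. c k *\<^sub>R d k)"
      by (rule sum.mono_neutral_cong_right) auto
    moreover have "(\<Sum>k<?M. (if k = i then a else 0) *\<^sub>R d k) = a *\<^sub>R d i"
      by (subst sum.cong[where h = "\<lambda>k. if k = i then a *\<^sub>R d i else 0"]) auto
    ultimately have "a *\<^sub>R v + y = (\<Sum>k<?M. ?c k *\<^sub>R d k)"
      by (simp add: y v scaleR_add_left sum.distrib)
    then show ?case by (intro exI[of _ ?M] exI[of _ ?c])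
  qed
  then show ?thesis using that by blast
qed

text \<open>The pairs \<open>(d k, b k)\<close> span a subspace; domination applied to a pair and to
  its negative gives equality.\<close>

lemma moment_functional:
  fixes d :: "nat \<Rightarrow> 'a::real_normed_vector" and b :: "nat \<Rightarrow> real"
  assumes R: "0 \<le> R" and dom: "\<And>c N. (\<Sum>k<N. c k * b k) \<le> R * norm (\<Sum>k<N. c k *\<^sub>R d k)"
  obtains g :: "'a \<Rightarrow>\<^sub>L real" where "norm g \<le> R" "\<And>k. g (d k) = b k"
proof -
  let ?K = "span (range (\<lambda>k. (d k, b k)))"
  have "is_cone ?K"
    by (auto simp: is_cone_def span_zero span_add span_scale)
  moreover have "s \<le> R * norm v" if vs: "(v, s) \<in> ?K" for v s
  proof -
    obtain N c where "(v, s) = (\<Sum>k<N. c k *\<^sub>R (d k, b k))" using in_span_range_natE[OF vs] .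
    then have "v = (\<Sum>k<N. c k *\<^sub>R d k)" "s = (\<Sum>k<N. c k * b k)"
      by (simp_all add: prod_eq_iff fst_sum snd_sum)
    then show ?thesis using dom by simp
  qed
  ultimately obtain g :: "'a \<Rightarrow>\<^sub>L real" where g: "norm g \<le> R" "\<forall>k\<in>?K. snd k \<le> blinfun_apply g (fst k)"
    using cone_domination[OF _ R] by blast
  have "g (d k) = b k" for k
  proof (rule antisym)
    have 1: "(d k, b k) \<in> ?K" by (auto intro: span_base)
    from bspec[OF g(2) this] show "b k \<le> g (d k)" by simp
    have "(- d k, - b k) \<in> ?K" using span_neg[OF 1] by simp
    from bspec[OF g(2) this] show "g (d k) \<le> b k" by (simp add: blinfun.minus_right)
  qed
  then show ?thesis using that g(1) by blast
qed

section \<open>The weak topology\<close>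

lemma topspace_weak_topology [simp]: "topspace (weak_topology :: 'a::real_normed_vector topology) = UNIV"
proof -
  have "UNIV \<in> {f -` U | (f :: 'a \<Rightarrow> real) U. bounded_linear f \<and> open U}"
    by (auto intro!: exI[of _ "\<lambda>_. 0"] exI[of _ UNIV])
  then show ?thesis unfolding weak_topology_def topology_generated_by_topspace by blast
qed

lemma openin_weak_vimage:
  fixes f :: "'a::real_normed_vector \<Rightarrow>\<^sub>L real"
  assumes "open U"
  shows "openin weak_topology (f -` U)"
  unfolding weak_topology_def
  by (rule topology_generated_by_Basis) (use assms blinfun.bounded_linear_right in blast)

lemma closedin_weak_vimage:
  fixes f :: "'a::real_normed_vector \<Rightarrow>\<^sub>L real"
  assumes "closed U"
  shows "closedin weak_topology (f -` U)"
  using openin_weak_vimage[of "- U" f] assms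
  by (simp add: closedin_def open_Compl vimage_Compl Compl_eq_Diff_UNIV[symmetric])

text \<open>Mazur's theorem: separation puts each outside point into a weakly open half-space that
  misses \<open>C\<close>.\<close>

lemma closedin_weak_closed_convex:
  fixes C :: "'a::real_normed_vector set"
  assumes C: "closed C" "convex C"
  shows "closedin weak_topology C"
proof -
  have "\<exists>T. openin weak_topology T \<and> x \<in> T \<and> T \<subseteq> - C" if x: "x \<notin> C" for x
  proof -
    obtain g :: "'a \<Rightarrow>\<^sub>L real" and r where g: "0 < r" "\<forall>c\<in>C. g x + r \<le> g c"
      using separate_point_closed_convex[OF C x] by metis
    have "x \<in> g -` {..<g x + r}" using g(1) by simp
    moreover have "y \<in> - C" if "y \<in> g -` {..<g x + r}" for y
      using g(2) that by force
    ultimately show ?thesis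
      using openin_weak_vimage[OF open_lessThan] by (intro exI conjI subsetI)
  qed
  then have "openin weak_topology (- C)" by (subst openin_subopen) blast
  then show ?thesis by (simp add: closedin_def Compl_eq_Diff_UNIV)
qed

lemma weakly_compact_subset:
  assumes "weakly_compact C" "D \<subseteq> C" "closed D" "convex D"
  shows "weakly_compact D"
  using closed_compactin[OF _ assms(2) closedin_weak_closed_convex[OF assms(3,4)]] assms(1)
  by (simp add: weakly_compact_def)

lemma weakly_compact_nest:
  fixes F :: "nat \<Rightarrow> 'a::real_normed_vector set"
  assumes C: "weakly_compact C" and F: "\<And>n. closedin weak_topology (F n)" "\<And>n. F n \<subseteq> C"
    "\<And>n. F n \<noteq> {}" "decseq F"
  shows "(\<Inter>n. F n) \<noteq> {}"
proof -
  have "C \<inter> \<Inter>\<F> \<noteq> {}" if fin: "finite \<F>" "\<F> \<subseteq> range F" for \<F>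
  proof -
    obtain N where N: "finite N" "\<F> = F ` N" using finite_subset_image[OF fin] by auto
    have "F (Max (insert 0 N)) \<subseteq> F n" if "n \<in> N" for n
      by (rule decseqD[OF F(4)]) (use N(1) that in simp)
    then have "F (Max (insert 0 N)) \<subseteq> C \<inter> \<Inter>\<F>" using F(2) N(2) by blast
    then show ?thesis using F(3)[of "Max (insert 0 N)"] by blast
  qed
  then have "C \<inter> \<Inter>(range F) \<noteq> {}"
    using C F(1) unfolding weakly_compact_def compactin_fip by (metis (no_types, lifting) imageE)
  then show ?thesis by auto
qed

lemma weakly_compact_functional_bounded:
  fixes f :: "'a::real_normed_vector \<Rightarrow>\<^sub>L real"
  assumes "weakly_compact C"
  shows "\<exists>B. \<forall>x\<in>C. \<bar>f x\<bar> \<le> B"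
proof (rule ccontr)
  assume *: "\<nexists>B. \<forall>x\<in>C. \<bar>f x\<bar> \<le> B"
  let ?U = "range (\<lambda>n::nat. f -` {x. \<bar>x\<bar> < real n})"
  have "\<forall>U\<in>?U. openin weak_topology U"
  proof
    fix U assume "U \<in> ?U"
    then obtain n :: nat where "U = f -` {x. \<bar>x\<bar> < real n}" by blast
    moreover have "open {x::real. \<bar>x\<bar> < real n}" by (intro open_Collect_less continuous_intros)
    ultimately show "openin weak_topology U" using openin_weak_vimage by blast
  qed
  moreover have "C \<subseteq> \<Union>?U" by (auto simp: reals_Archimedean2)
  ultimately obtain \<F> where \<F>: "finite \<F>" "\<F> \<subseteq> ?U" "C \<subseteq> \<Union>\<F>"
    using assms unfolding weakly_compact_def compactin_def by meson
  then obtain N where N: "finite N" "\<F> = (\<lambda>n::nat. f -` {x. \<bar>x\<bar> < real n}) ` N"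
    by (metis finite_subset_image)
  have "\<bar>f x\<bar> \<le> Max (insert 0 N)" if "x \<in> C" for x
  proof -
    have "x \<in> (\<Union>n\<in>N. f -` {x. \<bar>x\<bar> < real n})" using \<F>(3) N(2) that by blast
    then obtain n where "n \<in> N" "\<bar>f x\<bar> < real n" by auto
    moreover from this have "n \<le> Max (insert 0 N)" using N(1) by simp
    ultimately show ?thesis by linarith
  qed
  with * show False by blast
qed

text \<open>Baire's theorem in the Banach space of functionals gives a ball on which the functionals are
  uniformly bounded on \<open>C\<close>; norming functionals turn this into a bound of \<open>C\<close>.\<close>

lemma bounded_if_functionals_bounded:
  fixes C :: "'a::real_normed_vector set"
  assumes bd: "\<And>f :: 'a \<Rightarrow>\<^sub>L real. \<exists>B. \<forall>x\<in>C. \<bar>f x\<bar> \<le> B"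
  shows "bounded C"
proof -
  define E where "E n = {f :: 'a \<Rightarrow>\<^sub>L real. \<forall>x\<in>C. \<bar>f x\<bar> \<le> real n}" for n
  have clE: "closed (E n)" for n
  proof -
    have "E n = (\<Inter>x\<in>C. {f. \<bar>blinfun_apply f x\<bar> \<le> real n})" by (auto simp: E_def)
    moreover have "closed {f. \<bar>blinfun_apply f x\<bar> \<le> real n}" for x
      by (intro closed_Collect_le continuous_intros)
    ultimately show ?thesis by auto
  qed
  have cover: "\<Union>(range E) = UNIV"
  proof -
    have "\<exists>n. f \<in> E n" for f
    proof -
      obtain B where B: "\<forall>x\<in>C. \<bar>f x\<bar> \<le> B" using bd by blast
      obtain n where "B \<le> real n" using real_arch_simple by blast
      with B have "f \<in> E n" by (force simp: E_def)
      then show ?thesis ..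
    qed
    then show ?thesis by blast
  qed
  have "\<exists>n. interior (E n) \<noteq> {}"
  proof (rule ccontr)
    assume "\<not> ?thesis"
    then have "euclidean interior_of \<Union>(range E) = {}"
      by (intro Baire_category_alt) (auto simp: clE completely_metrizable_space_euclidean)
    then show False unfolding cover by simp
  qed
  then obtain n f where "f \<in> interior (E n)" by blast
  then obtain r where r: "0 < r" "cball f r \<subseteq> E n" by (auto simp: mem_interior_cball)
  have "norm x \<le> 2 * real n / r" if x: "x \<in> C" for x
  proof -
    obtain g :: "'a \<Rightarrow>\<^sub>L real" where g: "norm g \<le> 1" "g x = norm x" using norming_functional .
    have "f + r *\<^sub>R g \<in> E n" using r g by (auto simp: subset_eq dist_norm)
    moreover have "f \<in> E n" using r by auto
    ultimately have "\<bar>f x + r * g x\<bar> \<le> real n" "\<bar>f x\<bar> \<le> real n"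
      using x by (auto simp: E_def blinfun.add_left blinfun.scaleR_left)
    then have "r * norm x \<le> 2 * real n" using g(2) by (simp add: abs_le_iff)
    then show ?thesis using r(1) by (simp add: field_simps)
  qed
  then show ?thesis by (auto simp: bounded_iff)
qed

lemma weakly_compact_imp_bounded: "weakly_compact C \<Longrightarrow> bounded C"
  by (intro bounded_if_functionals_bounded weakly_compact_functional_bounded)

text \<open>The codomain carries the product topology, so closures of images are taken for pointwise
  convergence on functionals, as in the weak-star topology of the bidual. A limit is a mere
  function; its algebraic properties have to be recovered by approximation.\<close>

definition eval_functional :: "'a::real_normed_vector \<Rightarrow> ('a \<Rightarrow>\<^sub>L real) \<Rightarrow> real" where
  "eval_functional x f = f x"

text \<open>Every weakly open set is the preimage of an open set of the product: this is clear for
  subbasic sets, and preimages commute with intersections and unions. Covers therefore transfer to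
  the image.\<close>

lemma weakly_compact_if_compact_image:
  fixes C :: "'a::real_normed_vector set"
  assumes "compact (eval_functional ` C)"
  shows "weakly_compact C"
proof -
  have weak: "\<exists>V. open V \<and> U = eval_functional -` V" if "openin weak_topology U" for U :: "'a set"
  proof -
    from that have "generate_topology_on {f -` U | (f :: 'a \<Rightarrow> real) U. bounded_linear f \<and> open U} U"
      unfolding weak_topology_def by (rule openin_topology_generated_by)
    then show ?thesis
    proof induction
      case Empty
      show ?case by (intro exI[of _ "{}"]) auto
    next
      case (Int a b)
      then obtain A B where "open A" "a = eval_functional -` A" "open B" "b = eval_functional -` B" by blast
      then show ?case by (intro exI[of _ "A \<inter> B"]) auto
    next
      case (UN K)
      then obtain V where "\<And>k. k \<in> K \<Longrightarrow> open (V k) \<and> k = eval_functional -` V k" by metis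
      then show ?case by (intro exI[of _ "\<Union>(V ` K)"]) auto
    next
      case (Basis s)
      then obtain f :: "'a \<Rightarrow> real" and U where f: "bounded_linear f" "open U" "s = f -` U" by blast
      have "open ((\<lambda>h. h (Blinfun f)) -` U)"
        by (intro open_vimage f(2) continuous_on_product_coordinates)
      moreover have "s = eval_functional -` ((\<lambda>h. h (Blinfun f)) -` U)"
        by (auto simp: f(3) eval_functional_def bounded_linear_Blinfun_apply[OF f(1)])
      ultimately show ?case by blast
    qed
  qed
  show ?thesis
    unfolding weakly_compact_def compactin_def
  proof (intro conjI allI impI)
    fix \<U> assume \<U>: "(\<forall>U\<in>\<U>. openin weak_topology U) \<and> C \<subseteq> \<Union>\<U>"
    then obtain V where V: "\<And>U. U \<in> \<U> \<Longrightarrow> open (V U) \<and> U = eval_functional -` V U"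
      using weak by metis
    have "eval_functional ` C \<subseteq> (\<Union>U\<in>\<U>. V U)" using \<U> V by blast
    then obtain \<F> where \<F>: "\<F> \<subseteq> \<U>" "finite \<F>" "eval_functional ` C \<subseteq> (\<Union>U\<in>\<F>. V U)"
      using compactE_image[OF assms, of \<U> V] V by metis
    have "x \<in> \<Union>\<F>" if x: "x \<in> C" for x
    proof -
      have "eval_functional x \<in> (\<Union>U\<in>\<F>. V U)" using \<F>(3) x by blast
      then obtain U where U: "U \<in> \<F>" "eval_functional x \<in> V U" by blast
      then have "x \<in> U" using V[of U] \<F>(1) by (metis subsetD vimageI2)
      with U(1) show ?thesis by blast
    qed
    with \<F>(1,2) show "\<exists>\<F>. finite \<F> \<and> \<F> \<subseteq> \<U> \<and> C \<subseteq> \<Union>\<F>" by blast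
  qed simp
qed

text \<open>The image of \<open>C\<close> lies in a compact product of intervals. Were it closed, it
  would be compact and \<open>C\<close> weakly compact, so its closure has a point \<open>l\<close>
  outside it. Evaluation at a point of \<open>C\<close> differs from \<open>l\<close> by this
  choice, evaluation at any other point by separation.\<close>

lemma not_weakly_compact_limit_functional:
  fixes C :: "'a::real_normed_vector set"
  assumes C: "closed C" "convex C" "bounded C" and nc: "\<not> weakly_compact C"
  obtains l :: "('a \<Rightarrow>\<^sub>L real) \<Rightarrow> real"
  where "\<And>\<Phi> \<epsilon>. finite \<Phi> \<Longrightarrow> 0 < \<epsilon> \<Longrightarrow> \<exists>x\<in>C. \<forall>f\<in>\<Phi>. \<bar>blinfun_apply f x - l f\<bar> < \<epsilon>"
    and "\<And>x. \<exists>f. l f \<noteq> blinfun_apply f x"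
proof -
  let ?J = "eval_functional :: 'a \<Rightarrow> _"
  obtain M where M: "\<And>x. x \<in> C \<Longrightarrow> norm x \<le> M" using C(3) by (auto simp: bounded_iff)
  let ?P = "PiE UNIV (\<lambda>f :: 'a \<Rightarrow>\<^sub>L real. {- (norm f * M)..norm f * M})"
  have "compactin (product_topology (\<lambda>_. euclidean) UNIV) ?P"
    unfolding compactin_PiE by simp
  then have P: "compact ?P" by (simp add: euclidean_product_topology flip: compactin_euclidean_iff)
  have sub: "?J ` C \<subseteq> ?P"
  proof -
    have "\<bar>f x\<bar> \<le> norm f * M" if "x \<in> C" for x and f :: "'a \<Rightarrow>\<^sub>L real"
      using norm_blinfun[of f x] mult_left_mono[OF M[OF that], of "norm f"] by simp
    then show ?thesis by (force simp: eval_functional_def abs_le_iff)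
  qed
  have clP: "closed ?P"
  proof -
    have "?P = (\<Inter>f. {h. \<bar>h f\<bar> \<le> norm f * M})" by (auto simp: PiE_UNIV_domain Pi_iff abs_le_iff minus_le_iff)
    moreover have "closed {h. \<bar>h f\<bar> \<le> norm f * M}" for f :: "'a \<Rightarrow>\<^sub>L real"
      by (intro closed_Collect_le continuous_intros continuous_on_product_coordinates)
    ultimately show ?thesis by auto
  qed
  have "?P \<inter> closure (?J ` C) = closure (?J ` C)"
    using closure_minimal[OF sub clP] by (rule inf_absorb2)
  with compact_Int_closed[OF P closed_closure, of "?J ` C"] have "compact (closure (?J ` C))" by metis
  then have "closure (?J ` C) \<noteq> ?J ` C"
    using weakly_compact_if_compact_image nc by metis
  then obtain l where l: "l \<in> closure (?J ` C)" "l \<notin> ?J ` C"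
    using closure_subset by blast
  have 1: "\<exists>x\<in>C. \<forall>f\<in>\<Phi>. \<bar>blinfun_apply f x - l f\<bar> < \<epsilon>" if \<Phi>: "finite \<Phi>" "0 < \<epsilon>" for \<Phi> \<epsilon>
  proof -
    define U where "U = (\<Inter>f\<in>\<Phi>. {h. \<bar>h f - l f\<bar> < \<epsilon>})"
    have "open {h. \<bar>h f - l f\<bar> < \<epsilon>}" for f :: "'a \<Rightarrow>\<^sub>L real"
      by (intro open_Collect_less continuous_intros continuous_on_product_coordinates)
    then have "open U" unfolding U_def using \<Phi>(1) by (intro open_INT) auto
    moreover have "l \<in> U" using \<Phi>(2) by (simp add: U_def)
    ultimately have "U \<inter> ?J ` C \<noteq> {}"
      using l(1) open_Int_closure_eq_empty[of U "?J ` C"] by blast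
    then obtain x where "x \<in> C" "?J x \<in> U" by blast
    then show ?thesis by (intro bexI[of _ x]) (simp_all add: U_def eval_functional_def)
  qed
  have 2: "\<exists>f. l f \<noteq> blinfun_apply f x" for x
  proof (cases "x \<in> C")
    case True
    then have "l \<noteq> ?J x" using l(2) by blast
    then show ?thesis unfolding eval_functional_def fun_eq_iff by simp
  next
    case False
    obtain g :: "'a \<Rightarrow>\<^sub>L real" and r where g: "0 < r" "\<forall>c\<in>C. g x + r \<le> g c"
      using separate_point_closed_convex[OF C(1,2) False] by metis
    obtain c where "c \<in> C" "\<bar>g c - l g\<bar> < r" using 1[of "{g}" r] g(1) by auto
    with g(2) have "l g \<noteq> g x" by force
    then show ?thesis by blast
  qed
  show ?thesis by (rule that[OF 1 2])
qed

section \<open>Basic sequences\<close>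

text \<open>Grunblum's condition for basic sequences, with \<open>L\<close> as bound for the basis
  constant. It admits zero vectors; a lower bound on the norms is imposed separately.\<close>

definition head_bounded :: "real \<Rightarrow> (nat \<Rightarrow> 'a::real_normed_vector) \<Rightarrow> bool" where
  "head_bounded L d \<longleftrightarrow>
     (\<forall>c N m. m \<le> N \<longrightarrow> norm (\<Sum>k<m. c k *\<^sub>R d k) \<le> L * norm (\<Sum>k<N. c k *\<^sub>R d k))"

lemma head_boundedD:
  "head_bounded L d \<Longrightarrow> m \<le> N \<Longrightarrow> norm (\<Sum>k<m. c k *\<^sub>R d k) \<le> L * norm (\<Sum>k<N. c k *\<^sub>R d k)"
  by (auto simp: head_bounded_def)

text \<open>The bound on the largest head \<open>H\<close> is self-improving: the coefficients are controlled by \<open>H\<close>,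
  hence so is the effect of the tails on the functionals, and the smallness of \<open>\<Sum>e k\<close> lets one absorb it.\<close>

lemma head_bounded_criterion:
  fixes d :: "nat \<Rightarrow> 'a::real_normed_vector"
  assumes \<kappa>: "0 < \<kappa>" "\<kappa> \<le> 1" and e: "\<And>k. 0 \<le> e k" "\<And>N. (\<Sum>k<N. e k) \<le> \<kappa> / 4"
    and fn: "\<And>n w c. w \<in> span (d ` {..<n}) \<Longrightarrow> \<exists>f :: 'a \<Rightarrow>\<^sub>L real. norm f \<le> 1 \<and>
      \<kappa> * norm w \<le> \<bar>blinfun_apply f (w + c *\<^sub>R d n)\<bar> + \<bar>c\<bar> * (e n * norm (d n)) \<and>
      (\<forall>k>n. \<bar>blinfun_apply f (d k)\<bar> \<le> e k * norm (d k))"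
  shows "head_bounded (2 / \<kappa>) d"
  unfolding head_bounded_def
proof (intro allI impI)
  fix c :: "nat \<Rightarrow> real" and N m :: nat
  assume "m \<le> N"
  define h where "h n = (\<Sum>k<n. c k *\<^sub>R d k)" for n
  define H where "H = Max ((\<lambda>n. norm (h n)) ` {..N})"
  have hH: "norm (h n) \<le> H" if "n \<le> N" for n
    unfolding H_def using that by (intro Max_ge) auto
  have H0: "0 \<le> H" using hH[of 0] by (simp add: h_def)
  have cd: "\<bar>c k\<bar> * norm (d k) \<le> 2 * H" if "k < N" for k
  proof -
    have "c k *\<^sub>R d k = h (Suc k) - h k" by (simp add: h_def)
    then have "\<bar>c k\<bar> * norm (d k) = norm (h (Suc k) - h k)" by (metis norm_scaleR)
    also have "\<dots> \<le> H + H"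
      using norm_triangle_ineq4[of "h (Suc k)" "h k"] hH[of k] hH[of "Suc k"] that by simp
    finally show ?thesis by simp
  qed
  have step: "\<kappa> * norm (h n) \<le> norm (h N) + \<kappa> * H / 2" if n: "n \<le> N" for n
  proof (cases "n = N")
    case True
    then show ?thesis
      using \<kappa> H0 mult_right_mono[of \<kappa> 1 "norm (h n)"] by (simp add: add_increasing2)
  next
    case False
    then have nN: "n < N" using n by simp
    have "h n \<in> span (d ` {..<n})"
      unfolding h_def by (intro span_sum span_scale span_base) auto
    from fn[OF this, of "c n"] obtain f :: "'a \<Rightarrow>\<^sub>L real" where f: "norm f \<le> 1"
      "\<kappa> * norm (h n) \<le> \<bar>f (h n + c n *\<^sub>R d n)\<bar> + \<bar>c n\<bar> * (e n * norm (d n))"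
      "\<forall>k>n. \<bar>f (d k)\<bar> \<le> e k * norm (d k)" by blast
    have "h N = h (Suc n) + (\<Sum>k=Suc n..<N. c k *\<^sub>R d k)"
      unfolding h_def lessThan_atLeast0 using nN by (simp only: sum.atLeastLessThan_concat Suc_leI)
    then have "f (h (Suc n)) = f (h N) - (\<Sum>k=Suc n..<N. c k * f (d k))"
      by (simp add: blinfun.add_right blinfun.sum_right blinfun.scaleR_right)
    moreover have "\<bar>f (h N)\<bar> \<le> norm (h N)"
      using norm_blinfun[of f "h N"] mult_right_mono[OF f(1), of "norm (h N)"] by simp
    moreover have "\<bar>\<Sum>k=Suc n..<N. c k * f (d k)\<bar> \<le> (\<Sum>k=Suc n..<N. 2 * H * e k)"
    proof (rule order_trans[OF sum_abs], rule sum_mono)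
      fix k assume k: "k \<in> {Suc n..<N}"
      then have "\<bar>c k * f (d k)\<bar> \<le> \<bar>c k\<bar> * (e k * norm (d k))"
        using f(3) by (simp add: abs_mult mult_left_mono)
      also have "\<dots> = (\<bar>c k\<bar> * norm (d k)) * e k" by simp
      also have "\<dots> \<le> 2 * H * e k" using cd[of k] k e(1) by (intro mult_right_mono) auto
      finally show "\<bar>c k * f (d k)\<bar> \<le> 2 * H * e k" .
    qed
    moreover have "\<bar>c n\<bar> * (e n * norm (d n)) \<le> 2 * H * e n"
      using mult_right_mono[OF cd[OF nN] e(1)[of n]] by (simp add: ac_simps)
    moreover have "h n + c n *\<^sub>R d n = h (Suc n)" by (simp add: h_def)
    ultimately have "\<kappa> * norm (h n) \<le> norm (h N) + (2 * H * e n + (\<Sum>k=Suc n..<N. 2 * H * e k))"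
      using f(2) by simp
    also have "2 * H * e n + (\<Sum>k=Suc n..<N. 2 * H * e k) = (\<Sum>k=n..<N. 2 * H * e k)"
      using nN by (simp add: sum.atLeast_Suc_lessThan)
    also have "\<dots> = 2 * H * (\<Sum>k=n..<N. e k)" by (simp add: sum_distrib_left)
    finally have "\<kappa> * norm (h n) \<le> norm (h N) + 2 * H * (\<Sum>k=n..<N. e k)" .
    \<comment> \<open>The total \<open>\<kappa> / 4\<close> makes the error at most half of
      \<open>\<kappa> * H\<close>, which the left side absorbs once \<open>n\<close> is an index
      attaining \<open>H\<close>.\<close>
    moreover have "(\<Sum>k=n..<N. e k) \<le> (\<Sum>k<N. e k)"
      by (rule sum_mono2) (use e(1) in auto)
    then have "2 * H * (\<Sum>k=n..<N. e k) \<le> 2 * H * (\<kappa> / 4)"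
      using H0 e(2)[of N] by (intro mult_left_mono) auto
    ultimately show ?thesis by (simp add: mult.commute)
  qed
  have "H \<in> (\<lambda>n. norm (h n)) ` {..N}" unfolding H_def by (rule Max_in) auto
  then obtain n where n: "n \<le> N" "H = norm (h n)" by auto
  have "\<kappa> * H / 2 \<le> norm (h N)" using step[OF n(1)] n(2) by (simp add: field_simps)
  then have "H \<le> 2 / \<kappa> * norm (h N)" using \<kappa> by (simp add: field_simps)
  then show "norm (\<Sum>k<m. c k *\<^sub>R d k) \<le> 2 / \<kappa> * norm (\<Sum>k<N. c k *\<^sub>R d k)"
    using hH[OF \<open>m \<le> N\<close>] by (simp add: h_def)
qed

lemma head_bounded_coeff:
  assumes "head_bounded L d" "k < N"
  shows "\<bar>c k\<bar> * norm (d k) \<le> 2 * L * norm (\<Sum>k<N. c k *\<^sub>R d k)"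
proof -
  have "c k *\<^sub>R d k = (\<Sum>k<Suc k. c k *\<^sub>R d k) - (\<Sum>k<k. c k *\<^sub>R d k)" by simp
  then have "\<bar>c k\<bar> * norm (d k) = norm ((\<Sum>k<Suc k. c k *\<^sub>R d k) - (\<Sum>k<k. c k *\<^sub>R d k))"
    by (metis norm_scaleR)
  also have "\<dots> \<le> norm (\<Sum>k<Suc k. c k *\<^sub>R d k) + norm (\<Sum>k<k. c k *\<^sub>R d k)"
    by (rule norm_triangle_ineq4)
  also have "\<dots> \<le> L * norm (\<Sum>k<N. c k *\<^sub>R d k) + L * norm (\<Sum>k<N. c k *\<^sub>R d k)"
    using assms by (intro add_mono head_boundedD) auto
  finally show ?thesis by simp
qed

text \<open>Consecutive heads bound \<open>\<bar>c n\<bar> * norm (d n)\<close>, and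
  \<open>\<theta>\<close> turns this into a bound on the coefficient alone, uniformly in
  \<open>n\<close>. That is the domination needed to prescribe the values 0 and 1.\<close>

lemma head_bounded_biorthogonal:
  fixes d :: "nat \<Rightarrow> 'a::real_normed_vector"
  assumes hb: "head_bounded L d" and L: "0 \<le> L" and \<theta>: "0 < \<theta>" "\<And>k. \<theta> \<le> norm (d k)"
  obtains g :: "nat \<Rightarrow> 'a \<Rightarrow>\<^sub>L real"
  where "\<And>n. norm (g n) \<le> 2 * L / \<theta>" "\<And>n k. g n (d k) = (if k = n then 1 else 0)"
proof -
  have "\<exists>g :: 'a \<Rightarrow>\<^sub>L real. norm g \<le> 2 * L / \<theta> \<and> (\<forall>k. blinfun_apply g (d k) = (if k = n then 1 else 0))" for n
  proof -
    have "(\<Sum>k<N. c k * (if k = n then 1 else 0)) \<le> 2 * L / \<theta> * norm (\<Sum>k<N. c k *\<^sub>R d k)" for c N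
    proof (cases "n < N")
      case True
      have "c n * \<theta> \<le> \<bar>c n\<bar> * norm (d n)" using \<theta> by (intro mult_mono) auto
      also have "\<dots> \<le> 2 * L * norm (\<Sum>k<N. c k *\<^sub>R d k)"
        by (rule head_bounded_coeff[OF hb True])
      finally have "c n \<le> 2 * L / \<theta> * norm (\<Sum>k<N. c k *\<^sub>R d k)"
        using \<theta>(1) by (simp add: field_simps)
      then show ?thesis using True by (simp add: if_distrib cong: if_cong)
    next
      case False
      then have "(\<Sum>k<N. c k * (if k = n then 1 else 0)) = 0" by (intro sum.neutral) auto
      then show ?thesis using L \<theta> by simp
    qed
    then show ?thesis
      using moment_functional[of "2 * L / \<theta>" "\<lambda>k. if k = n then 1 else 0" d] L \<theta>(1)
      by (metis (no_types, lifting) divide_nonneg_pos mult_nonneg_nonneg zero_le_numeral)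
  qed
  then obtain g :: "nat \<Rightarrow> 'a \<Rightarrow>\<^sub>L real"
    where "\<forall>n. norm (g n) \<le> 2 * L / \<theta> \<and> (\<forall>k. blinfun_apply (g n) (d k) = (if k = n then 1 else 0))" by metis
  then show ?thesis using that by blast
qed

text \<open>Abel summation gives \<open>a N\<close> times the full head, minus heads weighted by the
  increments of \<open>a\<close>. The increments are nonnegative with total at most 1, so each of
  the two parts costs one factor \<open>L\<close>.\<close>

lemma monotone_multiplier_bound:
  fixes d :: "nat \<Rightarrow> 'a::real_normed_vector" and a :: "nat \<Rightarrow> real"
  assumes hb: "head_bounded L d" and a: "mono a" "\<And>k. 0 \<le> a k" "\<And>k. a k \<le> 1"
  shows "norm (\<Sum>k<N. (a k * c k) *\<^sub>R d k) \<le> 2 * L * norm (\<Sum>k<N. c k *\<^sub>R d k)"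
proof -
  define h where "h n = (\<Sum>k<n. c k *\<^sub>R d k)" for n
  define B where "B = L * norm (h N)"
  have hB: "norm (h n) \<le> B" if "n \<le> N" for n
    unfolding h_def B_def by (rule head_boundedD[OF hb that])
  then have B0: "0 \<le> B" using norm_ge_zero order_trans by blast
  have abel: "(\<Sum>k<n. (a k * c k) *\<^sub>R d k) = a n *\<^sub>R h n - (\<Sum>k<n. (a (Suc k) - a k) *\<^sub>R h (Suc k))" for n
    by (induction n) (simp_all add: h_def algebra_simps)
  have "norm (\<Sum>k<N. (a (Suc k) - a k) *\<^sub>R h (Suc k)) \<le> (\<Sum>k<N. (a (Suc k) - a k) * B)"
  proof (rule sum_norm_le)
    fix k assume "k \<in> {..<N}"
    then have "norm (h (Suc k)) \<le> B" using hB by simp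
    moreover have "a k \<le> a (Suc k)" using a(1) by (simp add: monoD)
    ultimately show "norm ((a (Suc k) - a k) *\<^sub>R h (Suc k)) \<le> (a (Suc k) - a k) * B"
      by (simp add: mult_left_mono)
  qed
  also have "\<dots> = (a N - a 0) * B"
    by (simp add: sum_lessThan_telescope flip: sum_distrib_right)
  also have "\<dots> \<le> 1 * B" using a(3)[of N] a(2)[of 0] B0 by (intro mult_right_mono) auto
  finally have "norm (\<Sum>k<N. (a (Suc k) - a k) *\<^sub>R h (Suc k)) \<le> B" by simp
  moreover have "norm (a N *\<^sub>R h N) \<le> 1 * B"
    unfolding norm_scaleR using a(2,3)[of N] hB[of N] by (intro mult_mono) auto
  ultimately show ?thesis
    using norm_triangle_ineq4[of "a N *\<^sub>R h N" "\<Sum>k<N. (a (Suc k) - a k) *\<^sub>R h (Suc k)"]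
    unfolding abel by (simp add: B_def h_def)
qed

text \<open>The point is the convex combination of consecutive \<open>x n\<close> whose weights are
  1 - a j and then the decrements of \<open>a\<close>. The induction peels off \<open>x j\<close>
  and rescales the remaining weights by \<open>a j\<close>.\<close>

lemma decreasing_weights_in_convex:
  fixes x :: "nat \<Rightarrow> 'a::real_vector" and a :: "nat \<Rightarrow> real"
  assumes S: "convex S" "range x \<subseteq> S"
    and a: "decseq a" "\<And>n. 0 \<le> a n" "\<And>n. a n \<le> 1"
  shows "x j + (\<Sum>n=j..<j+k. a n *\<^sub>R (x (Suc n) - x n)) \<in> S"
  using a
proof (induction k arbitrary: j a)
  case 0
  then show ?case using S by auto
next
  case (Suc k)
  \<comment> \<open>Truncation at 1 matters only at indices below \<open>j\<close>, where the ratio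
    may exceed 1 while the induction hypothesis asks for bounds at all indices. If
    \<open>a j = 0\<close>, the ratio is 0, and all later weights vanish too.\<close>
  define y where "y = x (Suc j) + (\<Sum>n=Suc j..<Suc j+k. min 1 (a n / a j) *\<^sub>R (x (Suc n) - x n))"
  have yS: "y \<in> S"
    unfolding y_def
  proof (rule Suc.IH)
    show "decseq (\<lambda>n. min 1 (a n / a j))"
      unfolding decseq_def
    proof (intro allI impI min.mono divide_right_mono)
      fix m n :: nat assume "m \<le> n"
      then show "a n \<le> a m" by (rule decseqD[OF Suc.prems(1)])
    qed (use Suc.prems(2) in auto)
  qed (use Suc.prems in auto)
  have mul: "a n = a j * min 1 (a n / a j)" if "j < n" for n
  proof -
    have le: "a n \<le> a j" using Suc.prems(1) that by (simp add: decseqD)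
    show ?thesis
    proof (cases "a j = 0")
      case True
      with le Suc.prems(2)[of n] show ?thesis by simp
    next
      case False
      with Suc.prems(2)[of j] have "0 < a j" by simp
      with le show ?thesis by (simp add: min_def field_simps)
    qed
  qed
  have "x j + (\<Sum>n=j..<j+Suc k. a n *\<^sub>R (x (Suc n) - x n))
      = x j + a j *\<^sub>R (x (Suc j) - x j) + (\<Sum>n=Suc j..<Suc j+k. a n *\<^sub>R (x (Suc n) - x n))"
    by (simp add: sum.atLeast_Suc_lessThan)
  also have "(\<Sum>n=Suc j..<Suc j+k. a n *\<^sub>R (x (Suc n) - x n))
      = a j *\<^sub>R (\<Sum>n=Suc j..<Suc j+k. min 1 (a n / a j) *\<^sub>R (x (Suc n) - x n))"
    unfolding scaleR_sum_right scaleR_scaleR by (rule sum.cong) (use mul in auto)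
  also have "x j + a j *\<^sub>R (x (Suc j) - x j) + \<dots> = (1 - a j) *\<^sub>R x j + a j *\<^sub>R y"
    by (simp add: y_def algebra_simps)
  also have "\<dots> \<in> S"
    using S yS Suc.prems(2,3)[of j] by (intro convexD) auto
  finally show ?case .
qed

section \<open>A nonergodic affine map on the hull of a sequence with basic differences\<close>

lemma closure_convex_hull_minimal:
  "S \<subseteq> C \<Longrightarrow> convex C \<Longrightarrow> closed C \<Longrightarrow> closure (convex hull S) \<subseteq> C"
  by (simp add: closure_minimal hull_minimal)

lemma subspace_closure:
  fixes S :: "'a::real_normed_vector set"
  assumes "subspace S"
  shows "subspace (closure S)"
  unfolding subspace_def
proof (intro conjI ballI allI)
  show "0 \<in> closure S" using assms closure_subset subspace_0 by blast
next
  fix x y assume "x \<in> closure S" "y \<in> closure S"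
  then obtain f g where "\<forall>n. f n \<in> S" "f \<longlonglongrightarrow> x" "\<forall>n. g n \<in> S" "g \<longlonglongrightarrow> y"
    unfolding closure_sequential by blast
  then show "x + y \<in> closure S"
    unfolding closure_sequential using assms
    by (intro exI[of _ "\<lambda>n. f n + g n"]) (auto intro: tendsto_add subspace_add)
next
  fix c :: real and x assume "x \<in> closure S"
  then obtain f where "\<forall>n. f n \<in> S" "f \<longlonglongrightarrow> x" unfolding closure_sequential by blast
  then show "c *\<^sub>R x \<in> closure S"
    unfolding closure_sequential using assms
    by (intro exI[of _ "\<lambda>n. c *\<^sub>R f n"]) (auto intro: tendsto_scaleR subspace_scale)
qed

text \<open>The witness is \<open>T y = y + (\<Sum>n. e n * (1 - g n (y - x 0)) *\<^sub>R d n)\<close>, which in the coordinates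
  \<open>g n\<close> contracts the distance to \<open>1\<close> by the factor \<open>1 - e n\<close>.\<close>

lemma nonergodic_if_head_bounded:
  fixes x :: "nat \<Rightarrow> 'a::banach"
  defines "d \<equiv> \<lambda>n. x (Suc n) - x n"
  assumes hb: "head_bounded L d" and \<theta>: "0 < \<theta>" "\<And>k. \<theta> \<le> norm (d k)"
  shows "\<not> ergodic_set (closure (convex hull range x))"
proof -
  define D where "D = closure (convex hull range x)"
  have D: "closed D" "convex D" "range x \<subseteq> D"
    unfolding D_def using hull_subset[of "range x" convex] closure_subset convex_closure by auto
  have L0: "0 \<le> L"
  proof -
    have "0 < norm (d 0)" by (rule less_le_trans[OF \<theta>])
    moreover have "norm (d 0) \<le> L * norm (d 0)"
      using head_boundedD[OF hb, of 1 1 "\<lambda>_. 1"] by simp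
    ultimately have "0 < L * norm (d 0)" by linarith
    then show ?thesis using \<open>0 < norm (d 0)\<close> by (simp add: zero_less_mult_iff)
  qed
  obtain g :: "nat \<Rightarrow> 'a \<Rightarrow>\<^sub>L real" where gn: "\<And>n. norm (g n) \<le> 2 * L / \<theta>"
    and gd: "\<And>n k. g n (d k) = (if k = n then 1 else 0)"
    using head_bounded_biorthogonal[OF hb L0 \<theta>] by metis
  define R where "R = 2 * L / \<theta>"
  have R0: "0 \<le> R" using L0 \<theta> by (simp add: R_def)
  have gR: "\<bar>g n w\<bar> \<le> R * norm w" for n w
    using norm_blinfun[of "g n" w] mult_right_mono[OF gn[of n], of "norm w"] by (simp add: R_def)
  \<comment> \<open>The power of 1/2 makes the series of \<open>e n *\<^sub>R d n\<close> absolutely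
    convergent however fast the norms grow. Summing all norms up to \<open>n\<close>, not only the
    last, makes \<open>e\<close> decreasing.\<close>
  define e where "e n = (1/2) ^ Suc n / (1 + (\<Sum>k\<le>n. norm (d k)))" for n
  have den: "1 \<le> 1 + (\<Sum>k\<le>n. norm (d k))" for n by (simp add: sum_nonneg)
  have e0: "0 < e n" for n
    unfolding e_def by (intro divide_pos_pos less_le_trans[OF zero_less_one den]) simp
  have e1: "e n \<le> 1/2" for n
  proof -
    have "e n \<le> (1/2) ^ Suc n / 1" unfolding e_def
      using den[of n] less_le_trans[OF zero_less_one den[of n]] by (intro divide_left_mono) auto
    also have "\<dots> \<le> 1/2" by (simp add: power_le_one)
    finally show ?thesis .
  qed
  have e1': "e n \<le> 1" for n using e1[of n] by simp
  have edec: "decseq e"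
  proof (rule decseq_SucI)
    fix n show "e (Suc n) \<le> e n"
      unfolding e_def using less_le_trans[OF zero_less_one den[of n]] by (intro frac_le) auto
  qed
  have ed: "norm (e n *\<^sub>R d n) \<le> (1/2) ^ Suc n" for n
  proof -
    have "norm (d n) \<le> 1 + (\<Sum>k\<le>n. norm (d k))"
      by (simp add: add_increasing sum_nonneg flip: lessThan_Suc_atMost)
    then have "norm (d n) / (1 + (\<Sum>k\<le>n. norm (d k))) \<le> 1" using den[of n] by simp
    then have "(1/2) ^ Suc n * (norm (d n) / (1 + (\<Sum>k\<le>n. norm (d k)))) \<le> (1/2) ^ Suc n * 1"
      by (intro mult_left_mono) auto
    moreover have "norm (e n *\<^sub>R d n) = (1/2) ^ Suc n * (norm (d n) / (1 + (\<Sum>k\<le>n. norm (d k))))"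
      unfolding norm_scaleR real_norm_def abs_of_pos[OF e0] by (simp add: e_def)
    ultimately show ?thesis by simp
  qed
  have sgeo: "summable (\<lambda>n. (1/2::real) ^ Suc n)" by (simp add: summable_mult)
  have sS: "summable (\<lambda>n. g n w *\<^sub>R e n *\<^sub>R d n)" and
    nS: "norm (\<Sum>n. g n w *\<^sub>R e n *\<^sub>R d n) \<le> norm w * (R * (\<Sum>n. (1/2::real) ^ Suc n))" for w
  proof -
    have *: "norm (g n w *\<^sub>R e n *\<^sub>R d n) \<le> (R * norm w) * (1/2) ^ Suc n" for n
      unfolding norm_scaleR[of "g n w"] using gR[of n w] ed[of n] by (intro mult_mono) auto
    have sm: "summable (\<lambda>n. (R * norm w) * (1/2) ^ Suc n)" by (rule summable_mult[OF sgeo])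
    have sn: "summable (\<lambda>n. norm (g n w *\<^sub>R e n *\<^sub>R d n))"
      by (rule summable_comparison_test'[OF sm, of 0]) (use * in auto)
    then show "summable (\<lambda>n. g n w *\<^sub>R e n *\<^sub>R d n)" by (rule summable_norm_cancel)
    have "norm (\<Sum>n. g n w *\<^sub>R e n *\<^sub>R d n) \<le> (\<Sum>n. norm (g n w *\<^sub>R e n *\<^sub>R d n))"
      by (rule summable_norm[OF sn])
    also have "\<dots> \<le> (\<Sum>n. (R * norm w) * (1/2) ^ Suc n)" by (rule suminf_le[OF * sn sm])
    also have "\<dots> = (R * norm w) * (\<Sum>n. (1/2) ^ Suc n)" by (rule suminf_mult[OF sgeo])
    finally show "norm (\<Sum>n. g n w *\<^sub>R e n *\<^sub>R d n) \<le> norm w * (R * (\<Sum>n. (1/2::real) ^ Suc n))"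
      by (simp only: ac_simps)
  qed
  have su: "summable (\<lambda>n. e n *\<^sub>R d n)"
    by (rule summable_norm_cancel, rule summable_comparison_test'[OF sgeo, of 0]) (use ed in auto)
  \<comment> \<open>\<open>S\<close> is diagonal on the \<open>d m\<close> and converges on the
    whole space, so \<open>V\<close> and \<open>T\<close> are continuous everywhere. A bound on the
    powers of \<open>V\<close> that is uniform in \<open>k\<close> will hold on the closed span
    \<open>E\<close>.\<close>
  define S where "S w = (\<Sum>n. g n w *\<^sub>R e n *\<^sub>R d n)" for w
  define u where "u = (\<Sum>n. e n *\<^sub>R d n)"
  have blS: "bounded_linear S"
  proof (rule bounded_linear_intro)
    show "S (v + w) = S v + S w" for v w
      unfolding S_def suminf_add[OF sS sS] by (simp add: blinfun.add_right algebra_simps)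
    show "S (r *\<^sub>R w) = r *\<^sub>R S w" for r w
      unfolding S_def suminf_scaleR_right[OF sS] by (simp add: blinfun.scaleR_right mult.assoc)
    show "norm (S w) \<le> norm w * (R * (\<Sum>n. (1/2::real) ^ Suc n))" for w
      unfolding S_def by (rule nS)
  qed
  define V where "V w = w - S w" for w
  have blV: "bounded_linear V" unfolding V_def by (intro bounded_linear_sub bounded_linear_ident blS)
  have blVk: "bounded_linear (V ^^ k)" for k
  proof (induction k)
    case 0
    show ?case by (simp add: id_def bounded_linear_ident)
  next
    case (Suc k)
    show ?case using bounded_linear_compose[OF blV Suc] by (simp add: comp_def)
  qed
  define T where "T y = x 0 + u + V (y - x 0)" for y
  have Sd: "S (d m) = e m *\<^sub>R d m" for m
  proof -
    have "(\<lambda>n. g n (d m) *\<^sub>R e n *\<^sub>R d n) = (\<lambda>n. if n = m then e n *\<^sub>R d n else 0)"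
      by (auto simp: gd)
    then show ?thesis
      unfolding S_def using sums_single[of m "\<lambda>n. e n *\<^sub>R d n"] by (simp add: sums_iff)
  qed
  have Vkd: "(V ^^ k) (d m) = (1 - e m) ^ k *\<^sub>R d m" for k m
  proof (induction k)
    case (Suc k)
    have "V (c *\<^sub>R d m) = (c * (1 - e m)) *\<^sub>R d m" for c
      unfolding V_def by (simp add: linear_scale[OF bounded_linear.linear[OF blS]] Sd algebra_simps)
    with Suc show ?case by (simp add: mult.commute)
  qed simp
  have gS: "g m (S w) = e m * g m w" for m w
  proof -
    have "g m (S w) = (\<Sum>n. g m (g n w *\<^sub>R e n *\<^sub>R d n))"
      unfolding S_def by (rule bounded_linear.suminf[OF blinfun.bounded_linear_right sS])
    also have "(\<lambda>n. g m (g n w *\<^sub>R e n *\<^sub>R d n)) = (\<lambda>n. if n = m then e n * g n w else 0)"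
      by (auto simp: blinfun.scaleR_right gd)
    also have "(\<Sum>n. if n = m then e n * g n w else 0) = e m * g m w"
      using sums_single[of m "\<lambda>n. e n * g n w"] by (simp add: sums_iff)
    finally show ?thesis .
  qed
  have gu: "g m u = e m" for m
  proof -
    have "g m u = (\<Sum>n. g m (e n *\<^sub>R d n))"
      unfolding u_def by (rule bounded_linear.suminf[OF blinfun.bounded_linear_right su])
    also have "(\<lambda>n. g m (e n *\<^sub>R d n)) = (\<lambda>n. if n = m then e n else 0)"
      by (auto simp: blinfun.scaleR_right gd)
    also have "(\<Sum>n. if n = m then e n else 0) = e m"
      using sums_single[of m e] by (simp add: sums_iff)
    finally show ?thesis .
  qed
  have gT: "1 - g m (T y - x 0) = (1 - e m) * (1 - g m (y - x 0))" for m y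
    by (simp add: T_def V_def blinfun.add_right blinfun.diff_right gS gu algebra_simps)
  have gTk: "1 - g m ((T ^^ k) (x 0) - x 0) = (1 - e m) ^ k" for m k
    by (induction k) (auto simp: gT)
  have Tdiff: "(T ^^ k) y - (T ^^ k) z = (V ^^ k) (y - z)" for k y z
  proof (induction k)
    case (Suc k)
    have "T a - T b = V (a - b)" for a b
      unfolding T_def using linear_diff[OF bounded_linear.linear[OF blV], of "a - x 0" "b - x 0"] by (simp add: algebra_simps)
    then show ?case using Suc by simp
  qed simp
  have aff: "T ((1 - t) *\<^sub>R y + t *\<^sub>R z) = (1 - t) *\<^sub>R T y + t *\<^sub>R T z" for t y z
  proof -
    have "(1 - t) *\<^sub>R y + t *\<^sub>R z - x 0 = (1 - t) *\<^sub>R (y - x 0) + t *\<^sub>R (z - x 0)"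
      by (simp add: algebra_simps)
    then have "V ((1 - t) *\<^sub>R y + t *\<^sub>R z - x 0) = (1 - t) *\<^sub>R V (y - x 0) + t *\<^sub>R V (z - x 0)"
      by (simp only: linear_add[OF bounded_linear.linear[OF blV]] linear_scale[OF bounded_linear.linear[OF blV]])
    then show ?thesis unfolding T_def by (simp add: algebra_simps)
  qed
  define E where "E = closure (span (range d))"
  have subE: "subspace E" unfolding E_def by (intro subspace_closure subspace_span)
  have xsum: "x j - x 0 = (\<Sum>n<j. d n)" for j
    by (simp add: d_def sum_lessThan_telescope)
  have DE: "y - x 0 \<in> E" if "y \<in> D" for y
  proof -
    let ?A = "(\<lambda>y. y - x 0) -` E"
    have "closed ?A" unfolding E_def by (intro closed_vimage continuous_intros) simp
    moreover have "convex ?A"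
    proof -
      have "?A = (\<lambda>w. x 0 + w) ` E"
        by (auto simp: image_iff) (metis add.commute diff_add_cancel)
      then show ?thesis using subspace_imp_convex[OF subE] by (simp add: convex_translation)
    qed
    moreover have "x j - x 0 \<in> span (range d)" for j
      unfolding xsum by (intro span_sum span_base) auto
    then have "range x \<subseteq> ?A" using closure_subset by (auto simp: E_def)
    ultimately have "D \<subseteq> ?A" unfolding D_def by (intro closure_convex_hull_minimal)
    with that show ?thesis by auto
  qed
  have TD: "T y \<in> D" if y: "y \<in> D" for y
  proof -
    have cT: "continuous_on UNIV T"
      unfolding T_def by (intro continuous_intros bounded_linear.continuous_on[OF blV])
    have "closed (T -` D)" using D(1) cT by (rule closed_vimage)
    moreover have "convex (T -` D)"
      unfolding convex_alt using D(2) by (auto simp: aff convex_alt)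
    \<comment> \<open>The preimage of \<open>D\<close> is closed and convex, so the points
      \<open>x j\<close> decide. \<open>T (x j)\<close> keeps the first \<open>j\<close>
      coefficients at 1 and gives the later ones the decreasing values \<open>e n\<close>; it is a
      limit of points with finitely many such weights.\<close>
    moreover have "T (x j) \<in> D" for j
    proof -
      have "g n (x j - x 0) = (if n < j then 1 else 0)" for n
        by (simp add: xsum blinfun.sum_right gd)
      then have eq: "e n *\<^sub>R d n - g n (x j - x 0) *\<^sub>R e n *\<^sub>R d n = (if n < j then 0 else e n *\<^sub>R d n)" for n
        by simp
      have "(\<lambda>n. e n *\<^sub>R d n - g n (x j - x 0) *\<^sub>R e n *\<^sub>R d n) sums (u - S (x j - x 0))"
        unfolding u_def S_def by (intro sums_diff summable_sums su sS)
      then have "(\<lambda>N. \<Sum>n<N. (if n < j then 0 else e n *\<^sub>R d n)) \<longlonglongrightarrow> u - S (x j - x 0)"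
        unfolding sums_def eq .
      then have "(\<lambda>k. \<Sum>n<k+j. (if n < j then 0 else e n *\<^sub>R d n)) \<longlonglongrightarrow> u - S (x j - x 0)"
        by (rule LIMSEQ_ignore_initial_segment)
      moreover have "(\<Sum>n<k+j. (if n < j then 0 else e n *\<^sub>R d n)) = (\<Sum>n=j..<j+k. e n *\<^sub>R d n)" for k
        by (rule sum.mono_neutral_cong_right) auto
      ultimately have lim: "(\<lambda>k. x j + (\<Sum>n=j..<j+k. e n *\<^sub>R d n)) \<longlonglongrightarrow> x j + (u - S (x j - x 0))"
        by (intro tendsto_add tendsto_const) simp
      have mem: "x j + (\<Sum>n=j..<j+k. e n *\<^sub>R d n) \<in> D" for k
        unfolding d_def
        by (rule decreasing_weights_in_convex[OF D(2,3) edec]) (use e0 e1' in \<open>auto intro: less_imp_le\<close>)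
      have "x j + (u - S (x j - x 0)) \<in> D"
        by (rule closed_sequentially[OF D(1) mem lim])
      moreover have "T (x j) = x j + (u - S (x j - x 0))" by (simp add: T_def V_def)
      ultimately show ?thesis by simp
    qed
    ultimately have "closure (convex hull range x) \<subseteq> T -` D"
      by (intro closure_convex_hull_minimal) auto
    then have "D \<subseteq> T -` D" by (simp only: D_def)
    with y show ?thesis by auto
  qed
  \<comment> \<open>\<open>V ^^ k\<close> multiplies the \<open>n\<close>-th coefficient by
    \<open>(1 - e n) ^ k\<close>, which increases with \<open>n\<close> and stays in [0, 1]. Hence
    the same bound for all \<open>k\<close>, first on the span and then on its closure.\<close>
  have Vbd: "norm ((V ^^ k) w) \<le> 2 * L * norm w" if w: "w \<in> E" for k w
  proof -
    have "closed {w. norm ((V ^^ k) w) \<le> 2 * L * norm w}"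
      by (intro closed_Collect_le continuous_intros bounded_linear.continuous_on[OF blVk])
    moreover have "norm ((V ^^ k) w) \<le> 2 * L * norm w" if w: "w \<in> span (range d)" for w
    proof -
      obtain N c where wc: "w = (\<Sum>n<N. c n *\<^sub>R d n)" using in_span_range_natE[OF w] .
      have "(V ^^ k) w = (\<Sum>n<N. ((1 - e n) ^ k * c n) *\<^sub>R d n)"
        unfolding wc linear_sum[OF bounded_linear.linear[OF blVk]] linear_scale[OF bounded_linear.linear[OF blVk]] Vkd
        by (simp add: mult.commute)
      also have "norm \<dots> \<le> 2 * L * norm w"
        unfolding wc
      proof (rule monotone_multiplier_bound[OF hb])
        show "mono (\<lambda>n. (1 - e n) ^ k)"
          using e1' by (intro monoI power_mono) (auto intro: decseqD[OF edec])
        show "0 \<le> (1 - e n) ^ k" "(1 - e n) ^ k \<le> 1" for n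
          using e1'[of n] e0[of n] by (auto intro: power_le_one)
      qed
      finally show ?thesis .
    qed
    ultimately have "E \<subseteq> {w. norm ((V ^^ k) w) \<le> 2 * L * norm w}"
      unfolding E_def by (intro closure_minimal) auto
    with w show ?thesis by auto
  qed
  have "T \<in> D \<rightarrow> D" using TD by auto
  moreover have "affine_fun_on D T" by (simp add: affine_fun_on_def aff)
  moreover have "cesaro_equicontinuous D T"
  proof -
    have lip: "dist (cesaro_mean T n y) (cesaro_mean T n z) \<le> 2 * L * dist y z"
      if "1 \<le> n" "y \<in> D" "z \<in> D" for n y z
    proof -
      have yz: "y - z \<in> E"
        using subspace_diff[OF subE DE[OF that(2)] DE[OF that(3)]] by simp
      have "cesaro_mean T n y - cesaro_mean T n z = (1 / real n) *\<^sub>R (\<Sum>k<n. (V ^^ k) (y - z))"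
        by (simp add: cesaro_mean_def Tdiff flip: scaleR_right_diff_distrib sum_subtractf)
      moreover have "norm (\<Sum>k<n. (V ^^ k) (y - z)) \<le> (\<Sum>k<n. 2 * L * norm (y - z))"
        by (rule sum_norm_le) (rule Vbd[OF yz])
      ultimately show ?thesis using that(1) by (simp add: dist_norm field_simps)
    qed
    show ?thesis
      unfolding cesaro_equicontinuous_def equicontinuous_on_def
    proof (intro ballI allI impI)
      fix y and \<epsilon> :: real assume y: "y \<in> D" and \<epsilon>: "0 < \<epsilon>"
      show "\<exists>\<delta>>0. \<forall>f\<in>{cesaro_mean T n |n. 1 \<le> n}. \<forall>z\<in>D. dist z y < \<delta> \<longrightarrow> dist (f z) (f y) < \<epsilon>"
      proof (intro exI[of _ "\<epsilon> / (2 * L + 1)"] conjI ballI impI)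
        show "0 < \<epsilon> / (2 * L + 1)" using \<epsilon> L0 by simp
        fix f z assume "f \<in> {cesaro_mean T n |n. 1 \<le> n}" "z \<in> D" and close: "dist z y < \<epsilon> / (2 * L + 1)"
        then have "dist (f z) (f y) \<le> 2 * L * dist z y" using lip y by auto
        also have "\<dots> \<le> (2 * L + 1) * dist z y" by (simp add: mult_right_mono)
        also have "\<dots> < \<epsilon>" using close L0 by (simp add: field_simps)
        finally show "dist (f z) (f y) < \<epsilon>" .
      qed
    qed
  qed
  moreover have "\<not> ergodic_fun D T"
  proof
    assume "ergodic_fun D T"
    then obtain y where y: "(\<lambda>n. cesaro_mean T n (x 0)) \<longlonglongrightarrow> y"
      using D(3) unfolding ergodic_fun_def convergent_def by blast
    have TkD: "(T ^^ k) (x 0) \<in> D" for k using D(3) TD by (induction k) auto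
    have Cd: "cesaro_mean T n (x 0) - x 0 = (1 / real n) *\<^sub>R (\<Sum>k<n. (T ^^ k) (x 0) - x 0)" if "1 \<le> n" for n
      using that by (simp add: cesaro_mean_def sum_subtractf scaleR_right_diff_distrib sum_constant_scaleR)
    have "y - x 0 \<in> E"
    proof (rule Lim_in_closed_set)
      show "closed E" by (simp add: E_def)
      show "((\<lambda>n. cesaro_mean T n (x 0) - x 0) \<longlongrightarrow> y - x 0) sequentially"
        by (intro tendsto_diff y tendsto_const)
      show "\<forall>\<^sub>F n in sequentially. cesaro_mean T n (x 0) - x 0 \<in> E"
        using eventually_ge_at_top[of 1]
        by eventually_elim (use subE DE TkD in \<open>auto simp: Cd intro!: subspace_scale subspace_sum\<close>)
    qed simp
    \<comment> \<open>The accuracy matches the bound \<open>R\<close> on the norms of the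
      \<open>g n\<close>. The coordinate of \<open>w\<close> at its cut-off \<open>N\<close> is 0,
      so that of \<open>y - x 0\<close> is below 1, whereas the means force it to be 1.\<close>
    then obtain w where w: "w \<in> span (range d)" "dist w (y - x 0) < 1 / (R + 1)"
      unfolding E_def closure_approachable using R0 by (metis add_nonneg_pos zero_less_divide_1_iff zero_less_one)
    obtain N c where wc: "w = (\<Sum>n<N. c n *\<^sub>R d n)" using in_span_range_natE[OF w(1)] .
    have "(\<lambda>n. g N (cesaro_mean T n (x 0) - x 0)) \<longlonglongrightarrow> g N (y - x 0)"
      by (intro tendsto_intros y)
    moreover have "(\<lambda>n. g N (cesaro_mean T n (x 0) - x 0)) \<longlonglongrightarrow> 1"
    proof -
      have eq: "g N (cesaro_mean T n (x 0) - x 0) = 1 - (1 / real n) * ((1 - (1 - e N) ^ n) / e N)" if "1 \<le> n" for n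
      proof -
        have "g N (cesaro_mean T n (x 0) - x 0) = (1 / real n) * (\<Sum>k<n. g N ((T ^^ k) (x 0) - x 0))"
          using that by (simp add: Cd blinfun.scaleR_right blinfun.sum_right)
        also have "(\<Sum>k<n. g N ((T ^^ k) (x 0) - x 0)) = (\<Sum>k<n. 1 - (1 - e N) ^ k)"
          by (rule sum.cong) (use gTk[of N] in \<open>auto simp: algebra_simps\<close>)
        also have "\<dots> = real n - (1 - (1 - e N) ^ n) / e N"
          using e0[of N] by (simp add: sum_subtractf sum_gp_strict)
        finally show ?thesis using that by (simp add: right_diff_distrib)
      qed
      have "(\<lambda>n. 1 - (1 / real n) * ((1 - (1 - e N) ^ n) / e N)) \<longlonglongrightarrow> 1 - 0 * ((1 - 0) / e N)"
        using e0[of N] e1[of N] lim_1_over_n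
        by (intro tendsto_intros LIMSEQ_power_zero) auto
      moreover have "\<forall>\<^sub>F n in sequentially. 1 - (1 / real n) * ((1 - (1 - e N) ^ n) / e N) = g N (cesaro_mean T n (x 0) - x 0)"
        using eventually_ge_at_top[of 1] by eventually_elim (simp add: eq)
      ultimately show ?thesis using tendsto_cong by fastforce
    qed
    ultimately have "g N (y - x 0) = 1" using LIMSEQ_unique by blast
    moreover have "g N w = 0" unfolding wc by (simp add: blinfun.sum_right blinfun.scaleR_right gd)
    ultimately have "1 = \<bar>g N (y - x 0 - w)\<bar>" by (simp only: blinfun.diff_right)
    also have "\<dots> \<le> R * norm (y - x 0 - w)" by (rule gR)
    also have "\<dots> \<le> (R + 1) * norm (y - x 0 - w)" by (simp add: mult_right_mono)
    also have "\<dots> < 1" using w(2) R0 by (simp add: dist_norm norm_minus_commute field_simps)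
    finally show False by simp
  qed
  ultimately show ?thesis unfolding ergodic_set_def D_def by blast
qed

section \<open>Bounded sets that are not weakly compact\<close>

lemma compact_span_Int_cball:
  fixes B :: "'a::real_normed_vector set"
  assumes "finite B"
  shows "compact (span B \<inter> cball 0 r)"
  using assms
proof (induction B arbitrary: r)
  case empty
  have "{0::'a} \<inter> cball 0 r = (if 0 \<le> r then {0} else {})" by auto
  then show ?case by simp
next
  case (insert b B)
  show ?case
  proof (cases "b \<in> span B")
    case True
    then show ?thesis using insert.IH by (simp add: span_redundant)
  next
    case False
    have "closed (span B)"
      unfolding closed_sequential_limits
    proof (intro allI impI)
      fix f l assume f: "(\<forall>n. f n \<in> span B) \<and> f \<longlonglongrightarrow> l"
      then have "Bseq f" using convergent_imp_Bseq convergent_def by blast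
      then obtain R where R: "\<And>n. norm (f n) \<le> R" unfolding Bseq_def by blast
      have "f n \<in> span B \<inter> cball 0 R" for n using f R by simp
      then have "l \<in> span B \<inter> cball 0 R"
        using f closed_sequentially[OF compact_imp_closed[OF insert.IH]] by metis
      then show "l \<in> span B" by simp
    qed
    then have "open (- span B)" by auto
    then obtain \<delta> where \<delta>: "0 < \<delta>" "ball b \<delta> \<subseteq> - span B" using False openE by blast
    \<comment> \<open>The distance \<open>\<delta>\<close> bounds the coefficient of
      \<open>b\<close> in a vector of norm at most \<open>r\<close> by \<open>r / \<delta>\<close>.
      The component in \<open>span B\<close> then lies in a larger ball, which is why the induction
      runs over all radii.\<close>
    have far: "\<delta> \<le> norm (b - w)" if "w \<in> span B" for w
      using \<delta>(2) that by (force simp: subset_eq dist_norm)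
    let ?I = "(\<lambda>(w, t). w + t *\<^sub>R b) ` ((span B \<inter> cball 0 (r + r / \<delta> * norm b)) \<times> {- (r / \<delta>)..r / \<delta>})"
    have "compact ?I"
      by (intro compact_continuous_image compact_Times insert.IH compact_Icc)
        (auto simp: case_prod_unfold intro!: continuous_intros)
    then have "compact (?I \<inter> cball 0 r)" by (intro compact_Int_closed closed_cball)
    also have "?I \<inter> cball 0 r = span (insert b B) \<inter> cball 0 r"
    proof (intro equalityI subsetI)
      fix v assume "v \<in> ?I \<inter> cball 0 r"
      then obtain w t where v: "v = w + t *\<^sub>R b" "w \<in> span B" "v \<in> cball 0 r" by auto
      then have "v - t *\<^sub>R b \<in> span B" by simp
      then show "v \<in> span (insert b B) \<inter> cball 0 r" using v(3) by (auto simp: span_insert)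
    next
      fix v assume v: "v \<in> span (insert b B) \<inter> cball 0 r"
      then obtain t where t: "v - t *\<^sub>R b \<in> span B" unfolding span_insert by blast
      have r0: "0 \<le> r" using v norm_ge_zero[of v] by (simp del: norm_ge_zero)
      have "\<bar>t\<bar> * \<delta> \<le> r"
      proof (cases "t = 0")
        case False
        have "(- (1 / t)) *\<^sub>R (v - t *\<^sub>R b) \<in> span B" using t by (rule span_scale)
        from far[OF this] have "\<bar>t\<bar> * \<delta> \<le> \<bar>t\<bar> * norm (b - (- (1 / t)) *\<^sub>R (v - t *\<^sub>R b))"
          by (intro mult_left_mono) auto
        also have "\<dots> = norm (t *\<^sub>R (b - (- (1 / t)) *\<^sub>R (v - t *\<^sub>R b)))" by simp
        also have "t *\<^sub>R (b - (- (1 / t)) *\<^sub>R (v - t *\<^sub>R b)) = v"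
          using False by (simp add: algebra_simps)
        finally show ?thesis using v by simp
      qed (use r0 in simp)
      then have tr: "\<bar>t\<bar> \<le> r / \<delta>" using \<delta>(1) by (simp add: field_simps)
      have "norm (v - t *\<^sub>R b) \<le> norm v + \<bar>t\<bar> * norm b"
        using norm_triangle_ineq4[of v "t *\<^sub>R b"] by simp
      also have "\<dots> \<le> r + r / \<delta> * norm b" using v tr by (intro add_mono mult_right_mono) auto
      finally have "(v - t *\<^sub>R b, t) \<in> (span B \<inter> cball 0 (r + r / \<delta> * norm b)) \<times> {- (r / \<delta>)..r / \<delta>}"
        using t tr by auto
      then have "v \<in> ?I" by (rule rev_image_eqI) simp
      then show "v \<in> ?I \<inter> cball 0 r" using v by blast
    qed
    finally show ?thesis .
  qed
qed

text \<open>A finite subcover of the unit sphere times an interval. \<open>ev\<close> records the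
  values of the functionals on one extra direction, possibly outside the space; for each fixed
  \<open>f\<close> the condition is open in \<open>(w, c)\<close>.\<close>

lemma finite_norming_set:
  fixes B :: "'a::real_normed_vector set" and ev :: "('a \<Rightarrow>\<^sub>L real) \<Rightarrow> real"
  assumes B: "finite B"
    and ex: "\<And>w c. w \<in> span B \<Longrightarrow> norm w = 1 \<Longrightarrow> \<bar>c\<bar> \<le> R \<Longrightarrow>
      \<exists>f. norm f \<le> 1 \<and> \<kappa> < \<bar>blinfun_apply f w + c * ev f\<bar>"
  shows "\<exists>\<Phi>. finite \<Phi> \<and> (\<forall>f\<in>\<Phi>. norm f \<le> 1) \<and>
    (\<forall>w\<in>span B. \<forall>c. norm w = 1 \<longrightarrow> \<bar>c\<bar> \<le> R \<longrightarrow> (\<exists>f\<in>\<Phi>. \<kappa> < \<bar>blinfun_apply f w + c * ev f\<bar>))"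
proof -
  define K where "K = ((span B \<inter> cball 0 1) \<inter> sphere 0 1) \<times> {- R..R}"
  have "closed (sphere (0::'a) 1)" unfolding sphere_def by (intro closed_Collect_eq continuous_intros)
  then have K: "compact K"
    unfolding K_def
    by (intro compact_Times compact_Int_closed[OF compact_span_Int_cball[OF B]] compact_Icc)
  have op: "open {p. \<kappa> < \<bar>blinfun_apply f (fst p) + snd p * ev f\<bar>}" for f
    by (intro open_Collect_less continuous_intros)
  have cov: "K \<subseteq> (\<Union>f\<in>{f. norm f \<le> 1}. {p. \<kappa> < \<bar>blinfun_apply f (fst p) + snd p * ev f\<bar>})"
  proof
    fix p assume "p \<in> K"
    then have "fst p \<in> span B" "norm (fst p) = 1" "\<bar>snd p\<bar> \<le> R" by (auto simp: K_def)
    from ex[OF this] show "p \<in> (\<Union>f\<in>{f. norm f \<le> 1}. {p. \<kappa> < \<bar>blinfun_apply f (fst p) + snd p * ev f\<bar>})"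
      by auto
  qed
  obtain \<Phi> where \<Phi>: "\<Phi> \<subseteq> {f. norm f \<le> 1}" "finite \<Phi>"
    "K \<subseteq> (\<Union>f\<in>\<Phi>. {p. \<kappa> < \<bar>blinfun_apply f (fst p) + snd p * ev f\<bar>})"
    using compactE_image[OF K op cov] .
  have norming: "\<exists>f\<in>\<Phi>. \<kappa> < \<bar>blinfun_apply f w + c * ev f\<bar>"
    if "w \<in> span B" "norm w = 1" "\<bar>c\<bar> \<le> R" for w c
  proof -
    have "(w, c) \<in> K" using that by (auto simp: K_def)
    then have "(w, c) \<in> (\<Union>f\<in>\<Phi>. {p. \<kappa> < \<bar>blinfun_apply f (fst p) + snd p * ev f\<bar>})"
      using \<Phi>(3) by blast
    then show ?thesis by simp
  qed
  show ?thesis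
  proof (intro exI[of _ \<Phi>] conjI ballI allI impI)
    show "finite \<Phi>" by (rule \<Phi>(2))
    show "norm f \<le> 1" if "f \<in> \<Phi>" for f using \<Phi>(1) that by blast
  qed (rule norming)
qed

text \<open>Dependent choice on triples: points chosen so far, latest point, functionals in use.
  \<open>G\<close> says that the functionals norm what has been chosen, \<open>Q\<close> how the
  next point looks to them. Functionals accumulate, so each new point is tested by all earlier
  ones.\<close>

lemma select_sequence:
  fixes C :: "'a::real_normed_vector set"
    and G :: "'a set \<Rightarrow> 'a \<Rightarrow> ('a \<Rightarrow>\<^sub>L real) set \<Rightarrow> bool"
    and Q :: "nat \<Rightarrow> ('a \<Rightarrow>\<^sub>L real) set \<Rightarrow> 'a \<Rightarrow> 'a \<Rightarrow> bool"
  assumes ne: "C \<noteq> {}"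
    and norming: "\<And>X x. finite X \<Longrightarrow> X \<subseteq> C \<Longrightarrow> x \<in> X \<Longrightarrow>
      \<exists>\<Phi>. finite \<Phi> \<and> (\<forall>f\<in>\<Phi>. norm f \<le> 1) \<and> G X x \<Phi>"
    and mono: "\<And>X x \<Phi> \<Psi>. G X x \<Phi> \<Longrightarrow> \<Phi> \<subseteq> \<Psi> \<Longrightarrow> G X x \<Psi>"
    and next_point: "\<And>n \<Phi> x. finite \<Phi> \<Longrightarrow> \<forall>f\<in>\<Phi>. norm f \<le> 1 \<Longrightarrow> x \<in> C \<Longrightarrow> \<exists>y\<in>C. Q n \<Phi> x y"
  shows "\<exists>x \<Phi>. mono \<Phi> \<and> (\<forall>n. x n \<in> C \<and> (\<forall>f\<in>\<Phi> n. norm f \<le> 1) \<and>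
    G (x ` {..n}) (x n) (\<Phi> n) \<and> Q n (\<Phi> n) (x n) (x (Suc n)))"
proof -
  define P where "P n s \<longleftrightarrow> (case s of (X, x, \<Phi>) \<Rightarrow> finite X \<and> X \<subseteq> C \<and> x \<in> X \<and>
    finite \<Phi> \<and> (\<forall>f\<in>\<Phi>. norm f \<le> 1) \<and> G X x \<Phi> \<and> (n = 0 \<longrightarrow> X = {x}))"
    for n :: nat and s :: "'a set \<times> 'a \<times> ('a \<Rightarrow>\<^sub>L real) set"
  define S where "S n s t \<longleftrightarrow> (case s of (X, x, \<Phi>) \<Rightarrow> case t of (Y, y, \<Psi>) \<Rightarrow>
    Y = insert y X \<and> \<Phi> \<subseteq> \<Psi> \<and> Q n \<Phi> x y)"
    for n and s t :: "'a set \<times> 'a \<times> ('a \<Rightarrow>\<^sub>L real) set"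
  have "\<exists>s. P 0 s"
  proof -
    obtain x where "x \<in> C" using ne by blast
    moreover from this obtain \<Phi> where "finite \<Phi>" "\<forall>f\<in>\<Phi>. norm f \<le> 1" "G {x} x \<Phi>"
      using norming[of "{x}" x] by auto
    ultimately have "P 0 ({x}, x, \<Phi>)" by (simp add: P_def)
    then show ?thesis by blast
  qed
  moreover have "\<exists>t. P (Suc n) t \<and> S n s t" if Pns: "P n s" for n s
  proof -
    obtain X x \<Phi> where s: "s = (X, x, \<Phi>)" using prod_cases3 by blast
    have X: "finite X" "X \<subseteq> C" "x \<in> X" "finite \<Phi>" "\<forall>f\<in>\<Phi>. norm f \<le> 1"
      using Pns by (simp_all add: P_def s)
    then have "x \<in> C" by blast
    obtain y where y: "y \<in> C" "Q n \<Phi> x y" using next_point[OF X(4,5) \<open>x \<in> C\<close>] by blast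
    have "\<exists>\<Psi>. finite \<Psi> \<and> (\<forall>f\<in>\<Psi>. norm f \<le> 1) \<and> G (insert y X) y \<Psi>"
      by (rule norming) (use X y in auto)
    then obtain \<Psi> where \<Psi>: "finite \<Psi>" "\<forall>f\<in>\<Psi>. norm f \<le> 1" "G (insert y X) y \<Psi>" by blast
    have "G (insert y X) y (\<Phi> \<union> \<Psi>)" by (rule mono[OF \<Psi>(3)]) auto
    then have "P (Suc n) (insert y X, y, \<Phi> \<union> \<Psi>)"
      using X \<Psi> y by (auto simp: P_def)
    moreover have "S n s (insert y X, y, \<Phi> \<union> \<Psi>)" using y by (simp add: S_def s)
    ultimately show ?thesis by blast
  qed
  ultimately obtain s where s: "\<And>n. P n (s n)" "\<And>n. S n (s n) (s (Suc n))"
    using dependent_nat_choice[of P S] by metis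
  define X where "X n = fst (s n)" for n
  define x where "x n = fst (snd (s n))" for n
  define \<Phi> where "\<Phi> n = snd (snd (s n))" for n
  have sn: "s n = (X n, x n, \<Phi> n)" for n by (simp add: X_def x_def \<Phi>_def)
  have P: "X n \<subseteq> C" "x n \<in> X n" "\<forall>f\<in>\<Phi> n. norm f \<le> 1" "G (X n) (x n) (\<Phi> n)" for n
    using s(1)[of n] by (simp_all add: P_def sn)
  have X0: "X 0 = {x 0}" using s(1)[of 0] by (simp add: P_def sn)
  have S: "X (Suc n) = insert (x (Suc n)) (X n)" "\<Phi> n \<subseteq> \<Phi> (Suc n)" "Q n (\<Phi> n) (x n) (x (Suc n))" for n
    using s(2)[of n] by (simp_all add: S_def sn)
  have "X n = x ` {..n}" for n
    by (induction n) (simp_all add: X0 S(1) atMost_Suc)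
  moreover have "mono \<Phi>" by (rule incseq_SucI) (rule S(2))
  ultimately show ?thesis using P S(3) by (intro exI[of _ x] exI[of _ \<Phi>]) (metis subsetD)
qed

lemma sum_geometric_half_le: "(\<Sum>k<N. (1/2::real) ^ k) \<le> 2"
  by (simp add: sum_gp_strict)

lemma difference_in_span:
  assumes "w \<in> span ((\<lambda>n. x (Suc n) - x n) ` {..<n})"
  shows "w \<in> span (x ` {..n::nat})"
proof -
  have "(\<lambda>n. x (Suc n) - x n) ` {..<n} \<subseteq> span (x ` {..n})"
    by (auto intro!: span_diff intro: span_base)
  then show ?thesis using assms span_minimal[OF _ subspace_span] by blast
qed

text \<open>To the functionals in \<open>\<Phi> n\<close>, \<open>x (Suc n)\<close> is nearly
  \<open>l\<close>: the difference \<open>d n\<close> looks like \<open>l\<close> minus evaluation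
  at \<open>x n\<close>, and all later differences look like 0. As \<open>\<Phi> n\<close> norms the
  span of the chosen points enlarged by that direction, \<open>head_bounded_criterion\<close>
  applies.\<close>

lemma bounded_not_weakly_compact_sequence:
  fixes C :: "'a::banach set"
  assumes C: "closed C" "convex C" "bounded C" and nc: "\<not> weakly_compact C"
  shows "\<exists>x L \<theta>. range x \<subseteq> C \<and> head_bounded L (\<lambda>n. x (Suc n) - x n) \<and> 0 < \<theta> \<and>
    (\<forall>n. \<theta> \<le> norm (x (Suc n) - x n))"
proof -
  obtain l :: "('a \<Rightarrow>\<^sub>L real) \<Rightarrow> real" where
    lim: "\<And>\<Phi> \<epsilon>. finite \<Phi> \<Longrightarrow> 0 < \<epsilon> \<Longrightarrow> \<exists>x\<in>C. \<forall>f\<in>\<Phi>. \<bar>blinfun_apply f x - l f\<bar> < \<epsilon>"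
    and ne: "\<And>x. \<exists>f. l f \<noteq> blinfun_apply f x"
    using not_weakly_compact_limit_functional[OF C nc] by metis
  obtain x0 where x0: "x0 \<in> C" using lim[of "{}" 1] by auto
  obtain M where M: "\<And>x. x \<in> C \<Longrightarrow> norm x \<le> M" using C(3) by (auto simp: bounded_iff)
  have M0: "0 \<le> M" using M[OF x0] norm_ge_zero order_trans by blast
  have fle: "\<bar>blinfun_apply f y\<bar> \<le> norm y" if "norm f \<le> 1" for f :: "'a \<Rightarrow>\<^sub>L real" and y
    using norm_blinfun[of f y] mult_right_mono[OF that, of "norm y"] by simp
  \<comment> \<open>Homogeneity passes to the limit; it will extend an identity from the unit ball
    to all functionals.\<close>
  have scale: "l (r *\<^sub>R f) = r * l f" for r f
  proof -
    have "\<bar>l (r *\<^sub>R f) - r * l f\<bar> \<le> \<epsilon>" if \<epsilon>: "0 < \<epsilon>" for \<epsilon>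
    proof -
      define \<eta> where "\<eta> = \<epsilon> / (1 + \<bar>r\<bar>)"
      have \<eta>: "0 < \<eta>" "\<eta> * (1 + \<bar>r\<bar>) = \<epsilon>" using \<epsilon> by (auto simp: \<eta>_def)
      have "\<exists>x\<in>C. \<forall>h\<in>{r *\<^sub>R f, f}. \<bar>blinfun_apply h x - l h\<bar> < \<eta>" by (rule lim) (use \<eta> in auto)
      then obtain x where x: "\<bar>r * f x - l (r *\<^sub>R f)\<bar> < \<eta>" "\<bar>f x - l f\<bar> < \<eta>"
        by (auto simp: blinfun.scaleR_left)
      have "\<bar>r * (f x - l f)\<bar> \<le> \<bar>r\<bar> * \<eta>" unfolding abs_mult using x(2) by (intro mult_left_mono) auto
      moreover have "l (r *\<^sub>R f) - r * l f = r * (f x - l f) - (r * f x - l (r *\<^sub>R f))"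
        by (simp add: algebra_simps)
      ultimately have "\<bar>l (r *\<^sub>R f) - r * l f\<bar> \<le> \<bar>r\<bar> * \<eta> + \<eta>" using x(1) by linarith
      then show ?thesis using \<eta>(2) by (simp add: algebra_simps)
    qed
    then show ?thesis using field_le_epsilon[of "\<bar>l (r *\<^sub>R f) - r * l f\<bar>" 0] by simp
  qed
  \<comment> \<open>Points whose evaluations approximate \<open>l\<close> uniformly on the unit ball
    would form a Cauchy sequence, and completeness would make \<open>l\<close> an
    evaluation.\<close>
  have "\<exists>\<theta>>0. \<forall>x. \<exists>f. norm f \<le> 1 \<and> \<theta> \<le> \<bar>l f - blinfun_apply f x\<bar>"
  proof (rule ccontr)
    assume neg: "\<not> ?thesis"
    have "\<exists>x. \<forall>f. norm f \<le> 1 \<longrightarrow> \<bar>l f - blinfun_apply f x\<bar> < 1 / real (Suc n)" for n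
    proof -
      have "0 < 1 / real (Suc n)" by simp
      with neg show ?thesis by (metis not_le)
    qed
    then obtain y where y: "\<And>n f. norm f \<le> 1 \<Longrightarrow> \<bar>l f - blinfun_apply f (y n)\<bar> < 1 / real (Suc n)"
      by metis
    have "Cauchy y"
    proof (rule metric_CauchyI)
      fix \<epsilon> :: real assume "0 < \<epsilon>"
      then obtain N where N: "1 / real (Suc N) < \<epsilon> / 2" using nat_approx_posE[of "\<epsilon> / 2"] by auto
      have "dist (y m) (y n) < \<epsilon>" if mn: "N \<le> m" "N \<le> n" for m n
      proof -
        obtain f :: "'a \<Rightarrow>\<^sub>L real" where f: "norm f \<le> 1" "f (y m - y n) = norm (y m - y n)"
          using norming_functional .
        have small: "1 / real (Suc k) < \<epsilon> / 2" if "N \<le> k" for k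
          using N that by (intro le_less_trans[OF _ N]) (simp add: frac_le)
        show ?thesis
          using f(2) y[OF f(1), of m] y[OF f(1), of n] small[OF mn(1)] small[OF mn(2)]
          unfolding blinfun.diff_right dist_norm by linarith
      qed
      then show "\<exists>N. \<forall>m\<ge>N. \<forall>n\<ge>N. dist (y m) (y n) < \<epsilon>" by blast
    qed
    then obtain z where z: "y \<longlonglongrightarrow> z" using Cauchy_convergent_iff convergent_def by blast
    have unit: "l f = f z" if f: "norm f \<le> 1" for f
    proof -
      have "(\<lambda>n. l f - f (y n)) \<longlonglongrightarrow> 0"
      proof (rule Lim_null_comparison)
        show "\<forall>\<^sub>F n in sequentially. norm (l f - f (y n)) \<le> 1 / real (Suc n)"
          using y[OF f] by (intro always_eventually allI) (simp add: less_imp_le)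
        show "(\<lambda>n. 1 / real (Suc n)) \<longlonglongrightarrow> 0" by (rule LIMSEQ_Suc[OF lim_1_over_n])
      qed
      moreover have "(\<lambda>n. l f - f (y n)) \<longlonglongrightarrow> l f - f z" by (intro tendsto_intros z)
      ultimately show ?thesis using LIMSEQ_unique by fastforce
    qed
    have "l f = f z" for f
    proof (cases "f = 0")
      case False
      have "l ((1 / norm f) *\<^sub>R f) = ((1 / norm f) *\<^sub>R f) z" by (rule unit) simp
      then show ?thesis using False by (simp add: scale blinfun.scaleR_left)
    qed (use unit in simp)
    then show False using ne by blast
  qed
  then obtain \<theta> where \<theta>: "0 < \<theta>"
    and far: "\<And>x. \<exists>f. norm f \<le> 1 \<and> \<theta> \<le> \<bar>l f - blinfun_apply f x\<bar>" by blast
  have near: "\<bar>l f - blinfun_apply f x\<bar> \<le> 2 * M" if f: "norm f \<le> 1" and x: "x \<in> C" for f x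
  proof (rule field_le_epsilon)
    fix \<epsilon> :: real assume "0 < \<epsilon>"
    then obtain x' where x': "x' \<in> C" "\<bar>f x' - l f\<bar> < \<epsilon>" using lim[of "{f}" \<epsilon>] by auto
    have "\<bar>f x'\<bar> \<le> M" "\<bar>f x\<bar> \<le> M" using fle[OF f] M x x'(1) order_trans by blast+
    with x'(2) show "\<bar>l f - f x\<bar> \<le> 2 * M + \<epsilon>" by linarith
  qed
  \<comment> \<open>\<open>\<kappa>\<close> balances two regimes for a unit vector \<open>w\<close>
    plus \<open>c\<close> times the extra direction. If \<open>\<bar>c\<bar> * \<theta>\<close>
    exceeds \<open>\<kappa>\<close>, the distance of \<open>l\<close> from
    \<open>x - (1 / c) *\<^sub>R w\<close> suffices; otherwise a functional norming \<open>w\<close>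
    loses at most \<open>\<kappa> / \<theta> * (2 * M)\<close>, which is below
    \<open>1 - \<kappa>\<close> by \<open>\<kappa>M\<close>.\<close>
  define \<kappa> where "\<kappa> = \<theta> / (2 * M + 2 * \<theta>)"
  have \<kappa>: "0 < \<kappa>" "\<kappa> \<le> 1" using \<theta> M0 by (auto simp: \<kappa>_def field_simps)
  have \<kappa>M: "\<kappa> * (\<theta> + 2 * M) < \<theta>"
  proof -
    have "\<kappa> * (2 * M + 2 * \<theta>) = \<theta>" using \<theta> M0 by (simp add: \<kappa>_def)
    moreover have "\<kappa> * (\<theta> + 2 * M) < \<kappa> * (2 * M + 2 * \<theta>)" using \<kappa> \<theta> by (intro mult_strict_left_mono) auto
    ultimately show ?thesis by simp
  qed
  have sup: "\<exists>f. norm f \<le> 1 \<and> \<kappa> < \<bar>blinfun_apply f w + c * (l f - blinfun_apply f x)\<bar>"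
    if w: "norm w = 1" and x: "x \<in> C" for w c x
  proof (cases "\<kappa> < \<bar>c\<bar> * \<theta>")
    case True
    then have c: "c \<noteq> 0" using \<kappa> by auto
    obtain f where f: "norm f \<le> 1" "\<theta> \<le> \<bar>l f - blinfun_apply f (x - (1 / c) *\<^sub>R w)\<bar>" using far by blast
    have "\<bar>c\<bar> * \<theta> \<le> \<bar>c\<bar> * \<bar>l f - blinfun_apply f (x - (1 / c) *\<^sub>R w)\<bar>" using f(2) by (intro mult_left_mono) auto
    also have "\<dots> = \<bar>c * (l f - blinfun_apply f (x - (1 / c) *\<^sub>R w))\<bar>" by (simp add: abs_mult)
    also have "c * (l f - blinfun_apply f (x - (1 / c) *\<^sub>R w)) = f w + c * (l f - f x)"
      using c by (simp add: blinfun.diff_right blinfun.scaleR_right algebra_simps)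
    finally show ?thesis using f(1) True by auto
  next
    case False
    obtain f :: "'a \<Rightarrow>\<^sub>L real" where f: "norm f \<le> 1" "f w = norm w" using norming_functional .
    have "\<bar>c * (l f - f x)\<bar> \<le> \<bar>c\<bar> * (2 * M)"
      unfolding abs_mult using near[OF f(1) x] by (intro mult_left_mono) auto
    also have "\<dots> \<le> \<kappa> / \<theta> * (2 * M)"
      using False \<theta> M0 by (intro mult_right_mono) (auto simp: field_simps)
    also have "\<dots> < 1 - \<kappa>"
    proof -
      have "\<kappa> / \<theta> * (2 * M) + \<kappa> = \<kappa> * (\<theta> + 2 * M) / \<theta>" using \<theta> by (simp add: field_simps)
      also have "\<dots> < 1" using \<kappa>M \<theta> by simp
      finally show ?thesis by simp
    qed
    finally have "\<kappa> < \<bar>f w + c * (l f - f x)\<bar>" using f(2) w by linarith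
    with f(1) show ?thesis by blast
  qed
  define G where "G X x \<Phi> \<longleftrightarrow> (\<forall>w\<in>span X. \<forall>c. \<exists>f\<in>\<Phi>. \<kappa> * norm w \<le> \<bar>blinfun_apply f w + c * (l f - blinfun_apply f x)\<bar>) \<and>
    (\<exists>f\<in>\<Phi>. \<theta> \<le> \<bar>l f - blinfun_apply f x\<bar>)" for X x \<Phi>
  \<comment> \<open>Against the lower bound \<open>\<theta> / 2\<close> for
    \<open>norm (d n)\<close>, an absolute error \<open>4 * \<eta> n\<close> becomes a relative
    error \<open>8 * \<eta> n / \<theta>\<close>. The divisor 64 makes these sum to at most
    \<open>\<kappa> / 4\<close>.\<close>
  define \<eta> where "\<eta> n = \<kappa> * \<theta> / 64 * (1/2) ^ n" for n :: nat
  have \<eta>0: "0 < \<eta> n" for n using \<kappa> \<theta> by (simp add: \<eta>_def)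
  have \<eta>Suc: "\<eta> n = 2 * \<eta> (Suc n)" for n by (simp add: \<eta>_def)
  have \<eta>\<theta>: "\<eta> n \<le> \<theta> / 2" for n
  proof -
    have "\<kappa> * \<theta> / 64 * (1/2) ^ n \<le> \<theta> / 64 * 1"
      using \<kappa> \<theta> by (intro mult_mono) (auto simp: power_le_one)
    then show ?thesis using \<theta> by (simp add: \<eta>_def)
  qed
  have "\<exists>x \<Phi>. mono \<Phi> \<and> (\<forall>n. x n \<in> C \<and> (\<forall>f\<in>\<Phi> n. norm f \<le> 1) \<and>
    G (x ` {..n}) (x n) (\<Phi> n) \<and> (\<forall>f\<in>\<Phi> n. \<bar>blinfun_apply f (x (Suc n)) - l f\<bar> < \<eta> n))"
  proof (rule select_sequence)
    show "C \<noteq> {}" using x0 by blast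
    show "G X x \<Psi>" if "G X x \<Phi>" "\<Phi> \<subseteq> \<Psi>" for X x \<Phi> \<Psi>
      using that unfolding G_def by (meson subsetD)
    show "\<exists>y\<in>C. \<forall>f\<in>\<Phi>. \<bar>blinfun_apply f y - l f\<bar> < \<eta> n" if "finite \<Phi>" for n \<Phi>
      using lim[OF that \<eta>0] .
    fix X x assume X: "finite X" "X \<subseteq> C" "x \<in> X"
    then have xC: "x \<in> C" by blast
    obtain \<Phi> where \<Phi>: "finite \<Phi>" "\<forall>f\<in>\<Phi>. norm f \<le> 1"
      "\<forall>w\<in>span X. \<forall>c. norm w = 1 \<longrightarrow> \<bar>c\<bar> \<le> 2 / \<theta> \<longrightarrow>
        (\<exists>f\<in>\<Phi>. \<kappa> < \<bar>blinfun_apply f w + c * (l f - blinfun_apply f x)\<bar>)"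
      using finite_norming_set[OF X(1), of "2 / \<theta>" \<kappa> "\<lambda>f. l f - blinfun_apply f x"] sup[OF _ xC] by metis
    \<comment> \<open>Compactness only reaches \<open>\<bar>c\<bar> \<le> 2 / \<theta>\<close>. For
      larger \<open>c\<close>, \<open>f0\<close> sees at least 2 from the extra direction and loses
      at most 1 on a unit vector.\<close>
    obtain f0 where f0: "norm f0 \<le> 1" "\<theta> \<le> \<bar>l f0 - blinfun_apply f0 x\<bar>" using far by blast
    have unit: "\<exists>f\<in>insert f0 \<Phi>. \<kappa> \<le> \<bar>blinfun_apply f w + c * (l f - blinfun_apply f x)\<bar>"
      if w: "w \<in> span X" "norm w = 1" for w c
    proof (cases "\<bar>c\<bar> \<le> 2 / \<theta>")
      case True
      then show ?thesis using \<Phi>(3) w by (meson insertCI less_imp_le)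
    next
      case False
      then have "2 \<le> \<bar>c\<bar> * \<theta>" using \<theta> by (simp add: field_simps)
      also have "\<dots> \<le> \<bar>c * (l f0 - f0 x)\<bar>" unfolding abs_mult using f0(2) by (intro mult_left_mono) auto
      finally have "1 \<le> \<bar>f0 w + c * (l f0 - f0 x)\<bar>" using fle[OF f0(1), of w] w(2) by linarith
      then show ?thesis using \<kappa>(2) by (meson insertI1 order_trans)
    qed
    have "\<exists>f\<in>insert f0 \<Phi>. \<kappa> * norm w \<le> \<bar>blinfun_apply f w + c * (l f - blinfun_apply f x)\<bar>"
      if w: "w \<in> span X" for w c
    proof (cases "w = 0")
      case False
      define w' where "w' = (1 / norm w) *\<^sub>R w"
      have "w' \<in> span X" "norm w' = 1" unfolding w'_def using False w by (auto intro: span_scale)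
      from unit[OF this, of "c / norm w"] obtain f where f: "f \<in> insert f0 \<Phi>"
        "\<kappa> \<le> \<bar>blinfun_apply f w' + c / norm w * (l f - blinfun_apply f x)\<bar>" by blast
      have "norm w * \<kappa> \<le> norm w * \<bar>blinfun_apply f w' + c / norm w * (l f - blinfun_apply f x)\<bar>"
        using f(2) by (intro mult_left_mono) auto
      also have "\<dots> = \<bar>norm w * (blinfun_apply f w' + c / norm w * (l f - blinfun_apply f x))\<bar>"
        by (simp add: abs_mult)
      also have "norm w * (blinfun_apply f w' + c / norm w * (l f - blinfun_apply f x))
          = blinfun_apply f w + c * (l f - blinfun_apply f x)"
        using False by (simp add: w'_def blinfun.scaleR_right field_simps)
      finally show ?thesis using f(1) by (metis mult.commute)
    qed auto
    then have "G X x (insert f0 \<Phi>)" unfolding G_def using f0 by blast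
    with \<Phi> f0 show "\<exists>\<Phi>. finite \<Phi> \<and> (\<forall>f\<in>\<Phi>. norm f \<le> 1) \<and> G X x \<Phi>"
      by (intro exI[of _ "insert f0 \<Phi>"]) auto
  qed
  then obtain x \<Phi> where \<Phi>: "mono \<Phi>" and xC: "\<And>n. x n \<in> C" and \<Phi>1: "\<And>n. \<forall>f\<in>\<Phi> n. norm f \<le> 1"
    and G: "\<And>n. G (x ` {..n}) (x n) (\<Phi> n)"
    and close: "\<And>n. \<forall>f\<in>\<Phi> n. \<bar>blinfun_apply f (x (Suc n)) - l f\<bar> < \<eta> n"
    by metis
  define d where "d n = x (Suc n) - x n" for n
  have d\<theta>: "\<theta> / 2 \<le> norm (d n)" for n
  proof -
    obtain f where f: "f \<in> \<Phi> n" "\<theta> \<le> \<bar>l f - blinfun_apply f (x n)\<bar>" using G[of n] by (auto simp: G_def)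
    have "\<bar>f (x (Suc n)) - l f\<bar> < \<theta> / 2" using close[of n] f(1) \<eta>\<theta>[of n] by force
    then have "\<theta> / 2 \<le> \<bar>f (d n)\<bar>" using f(2) unfolding d_def blinfun.diff_right by linarith
    also have "\<dots> \<le> norm (d n)" using fle \<Phi>1[of n] f(1) by blast
    finally show ?thesis .
  qed
  have \<eta>d: "4 * \<eta> n \<le> 8 * \<eta> n / \<theta> * norm (d n)" for n
  proof -
    have "8 * \<eta> n / \<theta> * (\<theta> / 2) \<le> 8 * \<eta> n / \<theta> * norm (d n)"
      using \<eta>0[of n] \<theta> d\<theta>[of n] by (intro mult_left_mono) auto
    then show ?thesis using \<theta> by simp
  qed
  have "head_bounded (2 / \<kappa>) d"
  proof (rule head_bounded_criterion[OF \<kappa>, where e = "\<lambda>n. 8 * \<eta> n / \<theta>"])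
    show "0 \<le> 8 * \<eta> k / \<theta>" for k using \<eta>0[of k] \<theta> by simp
    show "(\<Sum>k<N. 8 * \<eta> k / \<theta>) \<le> \<kappa> / 4" for N
    proof -
      have "(\<Sum>k<N. 8 * \<eta> k / \<theta>) = \<kappa> / 8 * (\<Sum>k<N. (1/2) ^ k)"
        unfolding sum_distrib_left by (rule sum.cong) (use \<theta> in \<open>auto simp: \<eta>_def\<close>)
      also have "\<dots> \<le> \<kappa> / 8 * 2" using \<kappa> by (intro mult_left_mono sum_geometric_half_le) auto
      finally show ?thesis by simp
    qed
    fix n w c assume "w \<in> span (d ` {..<n})"
    then have "w \<in> span (x ` {..n})" using difference_in_span[of w x n] by (simp add: d_def[abs_def])
    then obtain f where f: "f \<in> \<Phi> n" "\<kappa> * norm w \<le> \<bar>blinfun_apply f w + c * (l f - blinfun_apply f (x n))\<bar>"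
      using G[of n] unfolding G_def by blast
    have "\<kappa> * norm w \<le> \<bar>blinfun_apply f (w + c *\<^sub>R d n)\<bar> + \<bar>c\<bar> * (8 * \<eta> n / \<theta> * norm (d n))"
    proof -
      have "\<bar>c * (f (x (Suc n)) - l f)\<bar> \<le> \<bar>c\<bar> * \<eta> n"
        unfolding abs_mult using close[of n] f(1) by (intro mult_left_mono) (auto intro: less_imp_le)
      also have "\<dots> \<le> \<bar>c\<bar> * (8 * \<eta> n / \<theta> * norm (d n))"
        using \<eta>d[of n] \<eta>0[of n] by (intro mult_left_mono) auto
      finally have "\<bar>c * (f (x (Suc n)) - l f)\<bar> \<le> \<bar>c\<bar> * (8 * \<eta> n / \<theta> * norm (d n))" .
      moreover have "f w + c * (l f - f (x n)) = f (w + c *\<^sub>R d n) - c * (f (x (Suc n)) - l f)"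
        by (simp add: d_def blinfun.add_right blinfun.scaleR_right blinfun.diff_right algebra_simps)
      ultimately show ?thesis using f(2) by linarith
    qed
    moreover have "\<bar>blinfun_apply f (d k)\<bar> \<le> 8 * \<eta> k / \<theta> * norm (d k)" if k: "n < k" for k
    proof -
      \<comment> \<open>\<open>x k\<close> was chosen against \<open>\<Phi> j\<close>, one index
        earlier, so the two ends of \<open>d k\<close> contribute errors below
        \<open>2 * \<eta> k\<close> and \<open>\<eta> k\<close>.\<close>
      obtain j where j: "k = Suc j" using k by (cases k) auto
      have "n \<le> j" "n \<le> k" using k j by auto
      then have "f \<in> \<Phi> j" "f \<in> \<Phi> k" using monoD[OF \<Phi>] f(1) by blast+
      then have "\<bar>f (x k) - l f\<bar> < \<eta> j" "\<bar>f (x (Suc k)) - l f\<bar> < \<eta> k" using close j by auto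
      then have "\<bar>f (d k)\<bar> \<le> 4 * \<eta> k"
        using \<eta>Suc[of j] \<eta>0[of k] j unfolding d_def blinfun.diff_right by auto
      then show ?thesis using \<eta>d[of k] by linarith
    qed
    ultimately show "\<exists>f :: 'a \<Rightarrow>\<^sub>L real. norm f \<le> 1 \<and>
      \<kappa> * norm w \<le> \<bar>blinfun_apply f (w + c *\<^sub>R d n)\<bar> + \<bar>c\<bar> * (8 * \<eta> n / \<theta> * norm (d n)) \<and>
      (\<forall>k>n. \<bar>blinfun_apply f (d k)\<bar> \<le> 8 * \<eta> k / \<theta> * norm (d k))"
      using \<Phi>1 f(1) by blast
  qed
  then show ?thesis
    using xC d\<theta> \<theta> unfolding d_def[abs_def]
    by (intro exI[of _ x] exI[of _ "2 / \<kappa>"] exI[of _ "\<theta> / 2"]) auto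
qed

section \<open>Unbounded sets\<close>

lemma convex_closed_dilation_vimage:
  fixes C :: "'a::real_normed_vector set"
  assumes "closed C" "convex C"
  shows "closed {z. x + r *\<^sub>R (z - x) \<in> C}" "convex {z. x + r *\<^sub>R (z - x) \<in> C}"
proof -
  have "closed ((\<lambda>z. x + r *\<^sub>R (z - x)) -` C)"
    using assms(1) by (rule closed_vimage) (intro continuous_intros)
  then show "closed {z. x + r *\<^sub>R (z - x) \<in> C}" by (simp add: vimage_def)
  show "convex {z. x + r *\<^sub>R (z - x) \<in> C}"
    unfolding convex_alt
  proof (intro ballI allI impI)
    fix a b and u :: real
    assume ab: "a \<in> {z. x + r *\<^sub>R (z - x) \<in> C}" "b \<in> {z. x + r *\<^sub>R (z - x) \<in> C}" and u: "0 \<le> u \<and> u \<le> 1"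
    have "(1 - u) *\<^sub>R (x + r *\<^sub>R (a - x)) + u *\<^sub>R (x + r *\<^sub>R (b - x)) \<in> C"
      using assms(2) ab u unfolding convex_alt by blast
    moreover have "(1 - u) *\<^sub>R (x + r *\<^sub>R (a - x)) + u *\<^sub>R (x + r *\<^sub>R (b - x))
        = x + r *\<^sub>R ((1 - u) *\<^sub>R a + u *\<^sub>R b - x)"
      by (simp add: algebra_simps)
    ultimately show "(1 - u) *\<^sub>R a + u *\<^sub>R b \<in> {z. x + r *\<^sub>R (z - x) \<in> C}" by simp
  qed
qed

lemma convex_segment_from:
  assumes C: "convex C" "x \<in> C" and r: "x + r *\<^sub>R v \<in> C" and s: "0 \<le> s" "s \<le> r"
  shows "x + s *\<^sub>R v \<in> C"
proof (cases "r = 0")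
  case False
  then have "(1 - s / r) *\<^sub>R x + (s / r) *\<^sub>R (x + r *\<^sub>R v) \<in> C"
    using C r s by (intro convexD_alt) auto
  moreover have "(1 - s / r) *\<^sub>R x + (s / r) *\<^sub>R (x + r *\<^sub>R v) = x + (s / r * r) *\<^sub>R v"
    by (simp add: scaleR_add_right scaleR_left_diff_distrib)
  ultimately show ?thesis using False by simp
qed (use s C in simp)

text \<open>If every long direction from \<open>x\<close> were seen by \<open>\<Phi>\<close>, the unit directions that stay in \<open>C\<close>
  up to distance \<open>n\<close> and are seen by \<open>\<Phi>\<close> would be nested weakly compact sets, and a common
  point would span a ray.\<close>

lemma unseen_direction:
  fixes C :: "'a::real_normed_vector set"
  assumes C: "closed C" "convex C" "\<not> bounded C"
    and wc: "\<And>D. D \<subseteq> C \<Longrightarrow> closed D \<Longrightarrow> convex D \<Longrightarrow> bounded D \<Longrightarrow> weakly_compact D"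
    and noray: "\<And>x y. y \<noteq> 0 \<Longrightarrow> \<exists>r\<ge>0. x + r *\<^sub>R y \<notin> C"
    and x: "x \<in> C" and \<Phi>: "finite \<Phi>" and \<epsilon>: "0 < \<epsilon>"
  shows "\<exists>y\<in>C. 1 \<le> norm (y - x) \<and> (\<forall>f\<in>\<Phi>. \<bar>blinfun_apply f (y - x)\<bar> \<le> \<epsilon> * norm (y - x))"
proof (rule ccontr)
  assume neg: "\<not> ?thesis"
  define A where "A r = (C \<inter> cball x 1) \<inter> {z. x + r *\<^sub>R (z - x) \<in> C}" for r
  \<comment> \<open>The length of a direction can be lost in a weak limit, but being seen by one of
    finitely many functionals cannot; this keeps the common point away from
    \<open>x\<close>.\<close>
  define W where "W = (\<Union>f\<in>\<Phi>. blinfun_apply f -` {t. \<epsilon> \<le> \<bar>t - blinfun_apply f x\<bar>})"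
  define F where "F n = A (real (Suc n)) \<inter> W" for n
  have "weakly_compact (C \<inter> cball x 1)"
    by (rule wc) (use C in \<open>auto intro: convex_Int closed_Int bounded_Int\<close>)
  moreover have "closedin weak_topology (F n)" for n
    unfolding F_def
  proof (rule closedin_Int)
    show "closedin weak_topology (A (real (Suc n)))"
      unfolding A_def
      by (intro closedin_weak_closed_convex closed_Int convex_Int convex_closed_dilation_vimage C closed_cball convex_cball)
    have "closedin weak_topology (blinfun_apply f -` {t. \<epsilon> \<le> \<bar>t - blinfun_apply f x\<bar>})" for f :: "'a \<Rightarrow>\<^sub>L real"
      by (intro closedin_weak_vimage closed_Collect_le continuous_intros)
    then show "closedin weak_topology W"
      unfolding W_def using \<Phi> by (intro closedin_Union) auto
  qed
  moreover have "F n \<subseteq> C \<inter> cball x 1" for n by (auto simp: F_def A_def)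
  moreover have "F n \<noteq> {}" for n
  proof -
    define r where "r = real (Suc n)"
    have r1: "1 \<le> r" by (simp add: r_def)
    obtain y where y: "y \<in> C" "r + norm x < norm y"
      using C(3) unfolding bounded_iff by (meson not_le)
    define s where "s = norm (y - x)"
    have s: "r \<le> s" using norm_triangle_sub[of y x] y(2) by (simp add: s_def)
    obtain f where f: "f \<in> \<Phi>" "\<epsilon> * s < \<bar>blinfun_apply f (y - x)\<bar>"
      using neg y(1) s r1 unfolding s_def by (meson not_le order_trans)
    define z where "z = x + (1 / s) *\<^sub>R (y - x)"
    have on_segment: "x + t *\<^sub>R (y - x) \<in> C" if "0 \<le> t" "t \<le> 1" for t
      by (rule convex_segment_from[OF C(2) x, of 1]) (use y(1) that in auto)
    have "z \<in> C" unfolding z_def by (rule on_segment) (use s r1 in \<open>auto simp: field_simps\<close>)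
    moreover have "dist x z \<le> 1" using s r1 by (simp add: z_def dist_norm s_def)
    moreover have "x + r *\<^sub>R (z - x) \<in> C"
      using on_segment[of "r / s"] s r1 by (simp add: z_def)
    moreover have "\<epsilon> \<le> \<bar>blinfun_apply f z - blinfun_apply f x\<bar>"
    proof -
      have "blinfun_apply f z - blinfun_apply f x = blinfun_apply f (y - x) / s"
        by (simp add: z_def blinfun.add_right blinfun.scaleR_right)
      moreover have "\<epsilon> \<le> \<bar>blinfun_apply f (y - x)\<bar> / s" using f(2) s r1 by (simp add: field_simps)
      ultimately show ?thesis using s r1 by simp
    qed
    ultimately have "z \<in> F n" using f(1) unfolding F_def r_def[symmetric] by (auto simp: A_def W_def)
    then show ?thesis by blast
  qed
  moreover have "decseq F"
  proof (rule decseq_SucI)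
    fix n
    have "x + real (Suc n) *\<^sub>R (z - x) \<in> C" if "x + real (Suc (Suc n)) *\<^sub>R (z - x) \<in> C" for z
      by (rule convex_segment_from[OF C(2) x that]) auto
    then show "F (Suc n) \<subseteq> F n" unfolding F_def A_def by blast
  qed
  ultimately have "(\<Inter>n. F n) \<noteq> {}" by (rule weakly_compact_nest)
  then obtain z where z: "\<And>n. z \<in> F n" by blast
  have "z \<noteq> x" using z[of 0] \<epsilon> by (auto simp: F_def W_def)
  then obtain r where r: "0 \<le> r" "x + r *\<^sub>R (z - x) \<notin> C" using noray[of "z - x" x] by auto
  obtain n where "r \<le> real n" using real_arch_simple by blast
  then have n: "r \<le> real (Suc n)" by simp
  have "x + real (Suc n) *\<^sub>R (z - x) \<in> C" using z[of n] unfolding F_def A_def by blast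
  from convex_segment_from[OF C(2) x this r(1) n] r(2) show False by blast
qed

text \<open>By \<open>unseen_direction\<close>, \<open>d n\<close> itself is nearly invisible to
  \<open>\<Phi> n\<close> in proportion to its length, so norming the span of the chosen points up
  to 1/2 is enough for \<open>head_bounded_criterion\<close>. The factor 1/16 in \<open>e\<close>
  makes the errors sum to at most 1/8, a quarter of that constant.\<close>

lemma unbounded_sequence:
  fixes C :: "'a::banach set"
  assumes C: "closed C" "convex C" "\<not> bounded C"
    and wc: "\<And>D. D \<subseteq> C \<Longrightarrow> closed D \<Longrightarrow> convex D \<Longrightarrow> bounded D \<Longrightarrow> weakly_compact D"
    and noray: "\<And>x y. y \<noteq> 0 \<Longrightarrow> \<exists>r\<ge>0. x + r *\<^sub>R y \<notin> C"
  shows "\<exists>x L \<theta>. range x \<subseteq> C \<and> head_bounded L (\<lambda>n. x (Suc n) - x n) \<and> 0 < \<theta> \<and>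
    (\<forall>n. \<theta> \<le> norm (x (Suc n) - x n))"
proof -
  define e where "e n = (1/16) * (1/2::real) ^ n" for n :: nat
  have e0: "0 < e n" for n by (simp add: e_def)
  define G where "G X x \<Phi> \<longleftrightarrow> (\<forall>w\<in>span X. w \<noteq> 0 \<longrightarrow> (\<exists>f\<in>\<Phi>. 1/2 * norm w \<le> \<bar>blinfun_apply f w\<bar>)) \<and> \<Phi> \<noteq> {}"
    for X and x :: 'a and \<Phi> :: "('a \<Rightarrow>\<^sub>L real) set"
  have "\<exists>x \<Phi>. mono \<Phi> \<and> (\<forall>n. x n \<in> C \<and> (\<forall>f\<in>\<Phi> n. norm f \<le> 1) \<and> G (x ` {..n}) (x n) (\<Phi> n) \<and>
    (1 \<le> norm (x (Suc n) - x n) \<and>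
      (\<forall>f\<in>\<Phi> n. \<bar>blinfun_apply f (x (Suc n) - x n)\<bar> \<le> e n * norm (x (Suc n) - x n))))"
  proof (rule select_sequence)
    show "C \<noteq> {}" using C(3) by auto
    show "G X x \<Psi>" if "G X x \<Phi>" "\<Phi> \<subseteq> \<Psi>" for X x \<Phi> \<Psi>
      using that unfolding G_def by (meson subsetD subset_empty)
    show "\<exists>y\<in>C. 1 \<le> norm (y - x) \<and> (\<forall>f\<in>\<Phi>. \<bar>blinfun_apply f (y - x)\<bar> \<le> e n * norm (y - x))"
      if "finite \<Phi>" "x \<in> C" for n \<Phi> x
      by (rule unseen_direction[OF C wc noray that(2,1) e0])
    fix X :: "'a set" and x assume X: "finite X"
    have ex: "\<exists>f :: 'a \<Rightarrow>\<^sub>L real. norm f \<le> 1 \<and> 1/2 < \<bar>blinfun_apply f w + c * (0::real)\<bar>"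
      if w: "norm w = 1" for w :: 'a and c :: real
    proof -
      obtain f :: "'a \<Rightarrow>\<^sub>L real" where "norm f \<le> 1" "f w = norm w" using norming_functional .
      with w show ?thesis by (intro exI[of _ f]) simp
    qed
    have "\<exists>\<Phi>. finite \<Phi> \<and> (\<forall>f\<in>\<Phi>. norm f \<le> 1) \<and>
      (\<forall>w\<in>span X. \<forall>c. norm w = 1 \<longrightarrow> \<bar>c\<bar> \<le> 0 \<longrightarrow> (\<exists>f\<in>\<Phi>. 1/2 < \<bar>blinfun_apply f w + c * (0::real)\<bar>))"
      by (rule finite_norming_set[OF X]) (rule ex)
    then obtain \<Phi> where \<Phi>: "finite \<Phi>" "\<forall>f\<in>\<Phi>. norm f \<le> 1"
      "\<forall>w\<in>span X. \<forall>c. norm w = 1 \<longrightarrow> \<bar>c\<bar> \<le> 0 \<longrightarrow> (\<exists>f\<in>\<Phi>. 1/2 < \<bar>blinfun_apply f w + c * (0::real)\<bar>)"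
      by (elim exE conjE)
    have "\<exists>f\<in>\<Phi>. 1/2 * norm w \<le> \<bar>blinfun_apply f w\<bar>" if w: "w \<in> span X" "w \<noteq> 0" for w
    proof -
      have "(1 / norm w) *\<^sub>R w \<in> span X" "norm ((1 / norm w) *\<^sub>R w) = 1"
        using w by (auto intro: span_scale)
      then obtain f where f: "f \<in> \<Phi>" "1/2 < \<bar>blinfun_apply f ((1 / norm w) *\<^sub>R w)\<bar>"
        using \<Phi>(3) by (metis abs_zero add_0_right mult_zero_right order_refl)
      then have "1/2 * norm w \<le> \<bar>blinfun_apply f w\<bar>" using w by (simp add: blinfun.scaleR_right field_simps)
      with f(1) show ?thesis by blast
    qed
    \<comment> \<open>The functional \<open>0\<close> ensures that a witness exists for
      \<open>w = 0\<close> too.\<close>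
    then have "G X x (insert 0 \<Phi>)" unfolding G_def by blast
    with \<Phi> show "\<exists>\<Phi>. finite \<Phi> \<and> (\<forall>f\<in>\<Phi>. norm f \<le> 1) \<and> G X x \<Phi>"
      by (intro exI[of _ "insert 0 \<Phi>"]) auto
  qed
  then obtain x \<Phi> where \<Phi>: "mono \<Phi>" and xC: "\<And>n. x n \<in> C" and \<Phi>1: "\<And>n. \<forall>f\<in>\<Phi> n. norm f \<le> 1"
    and G: "\<And>n. G (x ` {..n}) (x n) (\<Phi> n)" and far: "\<And>n. 1 \<le> norm (x (Suc n) - x n)"
    and small: "\<And>n. \<forall>f\<in>\<Phi> n. \<bar>blinfun_apply f (x (Suc n) - x n)\<bar> \<le> e n * norm (x (Suc n) - x n)"
    by metis
  define d where "d n = x (Suc n) - x n" for n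
  have "head_bounded (2 / (1/2)) d"
  proof (rule head_bounded_criterion[where e = e])
    show "0 \<le> e k" for k using e0[of k] by simp
    show "(\<Sum>k<N. e k) \<le> 1/2 / 4" for N
      using sum_geometric_half_le[of N] unfolding e_def sum_distrib_left[symmetric] by linarith
    fix n w c assume "w \<in> span (d ` {..<n})"
    then have w: "w \<in> span (x ` {..n})" using difference_in_span[of w x n] by (simp add: d_def[abs_def])
    obtain f where f: "f \<in> \<Phi> n" "1/2 * norm w \<le> \<bar>blinfun_apply f w\<bar>"
      using G[of n] w unfolding G_def by (cases "w = 0") auto
    have fd: "\<bar>blinfun_apply f (d k)\<bar> \<le> e k * norm (d k)" if "n \<le> k" for k
      using small[of k] monoD[OF \<Phi> that] f(1) by (auto simp: d_def)
    have "\<bar>c * f (d n)\<bar> \<le> \<bar>c\<bar> * (e n * norm (d n))"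
      unfolding abs_mult using fd[of n] by (intro mult_left_mono) auto
    moreover have "f (w + c *\<^sub>R d n) = f w + c * f (d n)" by (simp add: blinfun.add_right blinfun.scaleR_right)
    ultimately have "1/2 * norm w \<le> \<bar>blinfun_apply f (w + c *\<^sub>R d n)\<bar> + \<bar>c\<bar> * (e n * norm (d n))"
      using f(2) by linarith
    then show "\<exists>f :: 'a \<Rightarrow>\<^sub>L real. norm f \<le> 1 \<and>
      1/2 * norm w \<le> \<bar>blinfun_apply f (w + c *\<^sub>R d n)\<bar> + \<bar>c\<bar> * (e n * norm (d n)) \<and>
      (\<forall>k>n. \<bar>blinfun_apply f (d k)\<bar> \<le> e k * norm (d k))"
      using \<Phi>1 f(1) fd by (meson less_imp_le)
  qed auto
  then show ?thesis
    using xC far unfolding d_def[abs_def]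
    by (intro exI[of _ x] exI[of _ "2 / (1/2)"] exI[of _ 1]) auto
qed

section \<open>Rays, and the passage from ergodicity to weak compactness\<close>

lemma nonergodic_ray:
  fixes x y :: "'a::banach"
  assumes y: "y \<noteq> 0"
  defines "D \<equiv> {x + r *\<^sub>R y | r. 0 \<le> r}"
  shows "closed D" "convex D" "\<not> ergodic_set D"
proof -
  have D_eq: "D = (\<lambda>r. x + r *\<^sub>R y) ` {0..}" by (auto simp: D_def)
  show "convex D"
    unfolding convex_alt
  proof (intro ballI allI impI)
    fix a b and u :: real assume "a \<in> D" "b \<in> D" and u: "0 \<le> u \<and> u \<le> 1"
    then obtain r s where a: "a = x + r *\<^sub>R y" "0 \<le> r" and b: "b = x + s *\<^sub>R y" "0 \<le> s"
      by (auto simp: D_def)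
    have "(1 - u) *\<^sub>R a + u *\<^sub>R b = x + ((1 - u) * r + u * s) *\<^sub>R y"
      by (simp add: a b algebra_simps)
    moreover have "0 \<le> (1 - u) * r + u * s" using u a b by simp
    ultimately show "(1 - u) *\<^sub>R a + u *\<^sub>R b \<in> D" unfolding D_def by blast
  qed
  show "closed D"
    unfolding closed_sequential_limits
  proof (intro allI impI)
    fix a l assume al: "(\<forall>n. a n \<in> D) \<and> a \<longlonglongrightarrow> l"
    then have "\<forall>n. \<exists>r. a n = x + r *\<^sub>R y \<and> 0 \<le> r" by (auto simp: D_def)
    then obtain r where r: "\<And>n. a n = x + r n *\<^sub>R y" "\<And>n. 0 \<le> r n" by metis
    have "r = (\<lambda>n. norm (a n - x) / norm y)" using r y by (auto simp: fun_eq_iff)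
    then have "r \<longlonglongrightarrow> norm (l - x) / norm y" using al y by (auto intro!: tendsto_intros)
    then have "(\<lambda>n. x + r n *\<^sub>R y) \<longlonglongrightarrow> x + (norm (l - x) / norm y) *\<^sub>R y" by (intro tendsto_intros)
    moreover have "a = (\<lambda>n. x + r n *\<^sub>R y)" using r(1) by (simp add: fun_eq_iff)
    ultimately have "l = x + (norm (l - x) / norm y) *\<^sub>R y" using al LIMSEQ_unique by blast
    moreover have "0 \<le> norm (l - x) / norm y" by simp
    ultimately show "l \<in> D" unfolding D_def by blast
  qed
  define T where "T z = z + y" for z
  have Tk: "(T ^^ k) z = z + real k *\<^sub>R y" for k z
    by (induction k) (simp_all add: T_def algebra_simps)
  \<comment> \<open>Each mean is a translation, so equicontinuity is immediate, while the
    displacement, (n - 1) / 2 times \<open>y\<close>, is unbounded.\<close>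
  have mean: "cesaro_mean T n z = z + ((\<Sum>k<n. real k) / real n) *\<^sub>R y" if "1 \<le> n" for n z
    using that by (simp add: cesaro_mean_def Tk sum.distrib scaleR_add_right sum_constant_scaleR scaleR_sum_left[symmetric])
  have "T \<in> D \<rightarrow> D"
  proof
    fix z assume "z \<in> D"
    then obtain r where "z = x + r *\<^sub>R y" "0 \<le> r" by (auto simp: D_def)
    then have "T z = x + (r + 1) *\<^sub>R y" "0 \<le> r + 1" by (simp_all add: T_def algebra_simps)
    then show "T z \<in> D" unfolding D_def by blast
  qed
  moreover have "affine_fun_on D T" by (simp add: affine_fun_on_def T_def algebra_simps)
  moreover have "cesaro_equicontinuous D T"
    unfolding cesaro_equicontinuous_def equicontinuous_on_def by (auto simp: mean)
  moreover have "\<not> ergodic_fun D T"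
  proof
    assume "ergodic_fun D T"
    moreover have "x \<in> D" unfolding D_def by (intro CollectI exI[of _ 0]) simp
    ultimately have "convergent (\<lambda>n. cesaro_mean T n x)" by (simp add: ergodic_fun_def)
    then obtain l where "(\<lambda>n. cesaro_mean T n x) \<longlonglongrightarrow> l" by (auto simp: convergent_def)
    then have "(\<lambda>n. cesaro_mean T (Suc n) x) \<longlonglongrightarrow> l" by (rule LIMSEQ_Suc)
    then have "Bseq (\<lambda>n. cesaro_mean T (Suc n) x)" using convergent_imp_Bseq convergent_def by blast
    then obtain R where R: "\<And>n. norm (cesaro_mean T (Suc n) x) \<le> R" unfolding Bseq_def by blast
    have "real n / 2 * norm y \<le> R + norm x" for n
    proof -
      have "(\<Sum>k<Suc n. real k) = real n * real (Suc n) / 2"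
        by (induction n) (simp_all add: field_simps)
      then have "cesaro_mean T (Suc n) x = x + (real n / 2) *\<^sub>R y"
        by (simp add: mean del: of_nat_Suc)
      then have "norm (x + (real n / 2) *\<^sub>R y) \<le> R" using R[of n] by simp
      moreover have "norm ((real n / 2) *\<^sub>R y) \<le> norm (x + (real n / 2) *\<^sub>R y) + norm x"
        using norm_triangle_ineq4[of "x + (real n / 2) *\<^sub>R y" x] by simp
      ultimately show ?thesis by simp
    qed
    moreover obtain n where "2 * (R + norm x) / norm y < real n" using reals_Archimedean2 by blast
    then have "R + norm x < real n / 2 * norm y" using y by (simp add: field_simps)
    ultimately show False by (meson not_le)
  qed
  ultimately show "\<not> ergodic_set D" unfolding ergodic_set_def by blast
qed

text \<open>Bounded subsets come first, because the unbounded case takes their weak compactness as a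
  hypothesis. Once \<open>C\<close> is known to be bounded, the first case applies to
  \<open>C\<close> itself.\<close>

lemma weakly_compact_if_ergodic:
  fixes C :: "'a::banach set"
  assumes C: "closed C" "convex C"
    and erg: "\<And>D. D \<subseteq> C \<Longrightarrow> closed D \<Longrightarrow> convex D \<Longrightarrow> ergodic_set D"
  shows "weakly_compact C"
proof -
  have no_seq: False if "D \<subseteq> C" "closed D" "convex D" and ex: "\<exists>x L \<theta>. range x \<subseteq> D \<and> head_bounded L (\<lambda>n. x (Suc n) - x n) \<and> 0 < \<theta> \<and>
    (\<forall>n. \<theta> \<le> norm (x (Suc n) - x n))" for D
  proof -
    obtain x :: "nat \<Rightarrow> 'a" and L \<theta> where x: "range x \<subseteq> D" "head_bounded L (\<lambda>n. x (Suc n) - x n)" "0 < \<theta>"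
      "\<And>n. \<theta> \<le> norm (x (Suc n) - x n)" using ex by blast
    have "ergodic_set (closure (convex hull range x))"
    proof (rule erg)
      show "closure (convex hull range x) \<subseteq> C"
        using closure_convex_hull_minimal[OF x(1) that(3,2)] that(1) by blast
    qed (auto simp: convex_closure)
    then show False using nonergodic_if_head_bounded[OF x(2-4)] by blast
  qed
  have bdd: "weakly_compact D" if "D \<subseteq> C" "closed D" "convex D" "bounded D" for D
    using bounded_not_weakly_compact_sequence[OF that(2-4)] no_seq[OF that(1-3)] by blast
  have noray: "\<exists>r\<ge>0. x + r *\<^sub>R y \<notin> C" if "y \<noteq> 0" for x y
  proof (rule ccontr)
    assume "\<not> ?thesis"
    then have "{x + r *\<^sub>R y | r. 0 \<le> r} \<subseteq> C" by blast
    then show False using erg nonergodic_ray[OF that, of x] by blast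
  qed
  have "bounded C"
    using unbounded_sequence[OF C _ bdd noray] no_seq[OF order_refl C] by blast
  then show ?thesis using bdd[OF order_refl C] by blast
qed

section \<open>Ergodicity of weakly compact convex sets\<close>

lemma affine_fun_onD:
  "affine_fun_on D T \<Longrightarrow> x \<in> D \<Longrightarrow> y \<in> D \<Longrightarrow> 0 \<le> t \<Longrightarrow> t \<le> 1 \<Longrightarrow>
    T ((1 - t) *\<^sub>R x + t *\<^sub>R y) = (1 - t) *\<^sub>R T x + t *\<^sub>R T y"
  by (simp add: affine_fun_on_def)

text \<open>Means become iterated binary convex combinations, the kind about which convexity and
  affinity on a set speak directly.\<close>

lemma cesaro_mean_Suc:
  assumes "1 \<le> n"
  shows "cesaro_mean T (Suc n) x =
    (1 - 1 / real (Suc n)) *\<^sub>R cesaro_mean T n x + (1 / real (Suc n)) *\<^sub>R (T ^^ n) x"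
proof -
  have "(1 - 1 / real (Suc n)) * (1 / real n) = 1 / real (Suc n)"
    using assms by (simp add: field_simps)
  then show ?thesis by (simp add: cesaro_mean_def scaleR_add_right del: of_nat_Suc)
qed

lemma cesaro_mean_one [simp]: "cesaro_mean T (Suc 0) x = x"
  by (simp add: cesaro_mean_def)

lemma cesaro_mean_in_convex:
  assumes "convex S" "\<And>k. (T ^^ k) x \<in> S" "1 \<le> n"
  shows "cesaro_mean T n x \<in> S"
  using assms(3)
proof (induction n rule: dec_induct)
  case base
  show ?case using assms(2)[of 0] by simp
next
  case (step n)
  then show ?case
    unfolding cesaro_mean_Suc[OF step.hyps(1)]
    by (intro convexD_alt assms) (auto simp: divide_le_eq)
qed

lemma funpow_in: "T \<in> D \<rightarrow> D \<Longrightarrow> x \<in> D \<Longrightarrow> (T ^^ k) x \<in> D"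
  by (induction k) auto

lemma affine_fun_on_funpow:
  assumes T: "affine_fun_on D T" "T \<in> D \<rightarrow> D"
  shows "affine_fun_on D (T ^^ k)"
proof (induction k)
  case 0
  show ?case by (simp add: affine_fun_on_def)
next
  case (Suc k)
  then show ?case using T(1) funpow_in[OF T(2)] by (simp add: affine_fun_on_def)
qed

lemma affine_fun_on_cesaro_mean:
  assumes T: "affine_fun_on D T" "T \<in> D \<rightarrow> D"
  shows "affine_fun_on D (cesaro_mean T n)"
  unfolding affine_fun_on_def
proof (intro ballI)
  fix x y and t :: real assume xy: "x \<in> D" "y \<in> D" and t: "t \<in> {0..1}"
  have "(T ^^ k) ((1 - t) *\<^sub>R x + t *\<^sub>R y) = (1 - t) *\<^sub>R (T ^^ k) x + t *\<^sub>R (T ^^ k) y" for k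
    using affine_fun_onD[OF affine_fun_on_funpow[OF T] xy] t by simp
  then show "cesaro_mean T n ((1 - t) *\<^sub>R x + t *\<^sub>R y) = (1 - t) *\<^sub>R cesaro_mean T n x + t *\<^sub>R cesaro_mean T n y"
    unfolding cesaro_mean_def by (simp add: sum.distrib scaleR_add_right mult.commute flip: scaleR_sum_right)
qed

lemma cesaro_mean_shift:
  "cesaro_mean T n (T x) - cesaro_mean T n x = (1 / real n) *\<^sub>R ((T ^^ n) x - x)"
proof -
  have "(\<Sum>k<n. (T ^^ k) (T x)) - (\<Sum>k<n. (T ^^ k) x) = (T ^^ n) x - x"
    by (induction n) (simp_all add: funpow_swap1 diff_eq_eq add.commute add.left_commute)
  then show ?thesis by (simp add: cesaro_mean_def flip: scaleR_right_diff_distrib)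
qed

lemma affine_cesaro_mean:
  assumes T: "affine_fun_on D T" "T \<in> D \<rightarrow> D" and x: "x \<in> D" and D: "convex D" and n: "1 \<le> n"
  shows "T (cesaro_mean T n x) = cesaro_mean T n (T x)"
  using n
proof (induction n rule: dec_induct)
  case base
  show ?case by simp
next
  case (step n)
  have "cesaro_mean T n x \<in> D" using step.hyps D funpow_in[OF T(2) x] by (intro cesaro_mean_in_convex)
  then show ?case
    unfolding cesaro_mean_Suc[OF step.hyps(1)]
    by (subst affine_fun_onD[OF T(1)]) (auto simp: step.IH funpow_in[OF T(2) x] funpow_swap1 divide_le_eq)
qed

lemma cesaro_equicontinuousD:
  assumes "cesaro_equicontinuous D T" "x \<in> D" "0 < \<epsilon>"
  shows "\<exists>\<delta>>0. \<forall>n\<ge>1. \<forall>y\<in>D. dist y x < \<delta> \<longrightarrow> dist (cesaro_mean T n y) (cesaro_mean T n x) < \<epsilon>"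
  using assms unfolding cesaro_equicontinuous_def equicontinuous_on_def by blast

text \<open>The mean of index 2 is half the sum of the identity and \<open>T\<close>, so
  \<open>T\<close> is recovered from it.\<close>

lemma cesaro_equicontinuous_imp_continuous_on:
  assumes T: "cesaro_equicontinuous D T"
  shows "continuous_on D T"
proof -
  have "continuous_on D (cesaro_mean T 2)"
    unfolding continuous_on_iff
  proof (intro ballI allI impI)
    fix x and \<epsilon> :: real assume "x \<in> D" "0 < \<epsilon>"
    from cesaro_equicontinuousD[OF T this] obtain \<delta> where "0 < \<delta>"
      "\<forall>n\<ge>1. \<forall>y\<in>D. dist y x < \<delta> \<longrightarrow> dist (cesaro_mean T n y) (cesaro_mean T n x) < \<epsilon>" by blast
    then show "\<exists>d>0. \<forall>y\<in>D. dist y x < d \<longrightarrow> dist (cesaro_mean T 2 y) (cesaro_mean T 2 x) < \<epsilon>"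
      by (intro exI[of _ \<delta>]) simp
  qed
  then have "continuous_on D (\<lambda>x. 2 *\<^sub>R cesaro_mean T 2 x - x)" by (intro continuous_intros)
  moreover have "2 *\<^sub>R cesaro_mean T 2 x - x = T x" for x
    by (simp add: cesaro_mean_def numeral_2_eq_2)
  ultimately show ?thesis by simp
qed

text \<open>The displacement of an affine map is affine, so its norm is convex. Approximate
  fixedness thus spreads from the means to the closed convex hull of a tail.\<close>

lemma closed_affine_displacement:
  assumes D: "closed D" "convex D" and T: "continuous_on D T" "affine_fun_on D T"
  shows "closed {z \<in> D. norm (T z - z) \<le> \<epsilon>}" "convex {z \<in> D. norm (T z - z) \<le> \<epsilon>}"
proof -
  have "closed (D \<inter> (\<lambda>z. norm (T z - z)) -` {..\<epsilon>})"
    by (intro continuous_closed_preimage continuous_intros D T closed_atMost)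
  moreover have "D \<inter> (\<lambda>z. norm (T z - z)) -` {..\<epsilon>} = {z \<in> D. norm (T z - z) \<le> \<epsilon>}" by auto
  ultimately show "closed {z \<in> D. norm (T z - z) \<le> \<epsilon>}" by simp
  show "convex {z \<in> D. norm (T z - z) \<le> \<epsilon>}"
    unfolding convex_alt
  proof (intro ballI allI impI)
    fix a b and u :: real
    assume a: "a \<in> {z \<in> D. norm (T z - z) \<le> \<epsilon>}" and b: "b \<in> {z \<in> D. norm (T z - z) \<le> \<epsilon>}" and u: "0 \<le> u \<and> u \<le> 1"
    let ?z = "(1 - u) *\<^sub>R a + u *\<^sub>R b"
    have "T ?z - ?z = (1 - u) *\<^sub>R (T a - a) + u *\<^sub>R (T b - b)"
      using affine_fun_onD[OF T(2), of a b u] a b u by (simp add: algebra_simps)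
    also have "norm \<dots> \<le> (1 - u) * norm (T a - a) + u * norm (T b - b)"
      using u norm_triangle_ineq[of "(1 - u) *\<^sub>R (T a - a)" "u *\<^sub>R (T b - b)"] by simp
    also have "\<dots> \<le> (1 - u) * \<epsilon> + u * \<epsilon>" using a b u by (intro add_mono mult_left_mono) auto
    finally have "norm (T ?z - ?z) \<le> \<epsilon>" by (simp add: algebra_simps)
    moreover have "?z \<in> D" using D(2) a b u unfolding convex_alt by blast
    ultimately show "?z \<in> {z \<in> D. norm (T z - z) \<le> \<epsilon>}" by simp
  qed
qed

lemma cesaro_mean_shift_tendsto_zero:
  fixes D :: "'a::real_normed_vector set"
  assumes D: "bounded D" and T: "T \<in> D \<rightarrow> D" and x: "x \<in> D"
  shows "(\<lambda>n. cesaro_mean T n (T x) - cesaro_mean T n x) \<longlonglongrightarrow> 0"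
proof -
  obtain M where M: "\<And>y. y \<in> D \<Longrightarrow> norm y \<le> M" using D by (auto simp: bounded_iff)
  have bd: "norm ((T ^^ n) x - x) \<le> 2 * M" for n
    using norm_triangle_ineq4[of "(T ^^ n) x" x] M[OF funpow_in[OF T x], of n] M[OF x] by linarith
  show ?thesis
  proof (rule Lim_null_comparison)
    show "\<forall>\<^sub>F n in sequentially. norm (cesaro_mean T n (T x) - cesaro_mean T n x) \<le> 1 / real n * (2 * M)"
      unfolding cesaro_mean_shift norm_scaleR
      by (intro always_eventually allI mult_mono bd) auto
    show "(\<lambda>n. 1 / real n * (2 * M)) \<longlonglongrightarrow> 0"
      using tendsto_mult_left_zero[OF lim_1_over_n] .
  qed
qed

text \<open>A weak cluster point \<open>y\<close> of the means is replaced by a common point of the closed convex hulls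
  of their tails.  It is fixed by \<open>T\<close> and a norm limit of points \<open>z\<close> whose means are asymptotic
  to those of \<open>x\<close>, so equicontinuity at \<open>y\<close> makes the means of \<open>x\<close> converge to \<open>y\<close>.\<close>

lemma weakly_compact_imp_ergodic_set:
  fixes D :: "'a::banach set"
  assumes wc: "weakly_compact D" and D: "closed D" "convex D"
  shows "ergodic_set D"
  unfolding ergodic_set_def ergodic_fun_def
proof (intro allI impI ballI)
  fix T x assume asm: "T \<in> D \<rightarrow> D \<and> affine_fun_on D T \<and> cesaro_equicontinuous D T" and x: "x \<in> D"
  then have T: "T \<in> D \<rightarrow> D" "affine_fun_on D T" and eq: "cesaro_equicontinuous D T" by auto
  have bd: "bounded D" by (rule weakly_compact_imp_bounded[OF wc])
  have cont: "continuous_on D T" by (rule cesaro_equicontinuous_imp_continuous_on[OF eq])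
  have meanD: "cesaro_mean T n x \<in> D" if "1 \<le> n" for n
    by (rule cesaro_mean_in_convex[OF D(2) funpow_in[OF T(1) x] that])
  \<comment> \<open>\<open>Suc m\<close> excludes index 0, whose mean is the default value 0 and may
    lie outside \<open>D\<close>.\<close>
  define F where "F m = closure (convex hull ((\<lambda>n. cesaro_mean T n x) ` {Suc m..}))" for m
  have FD: "F m \<subseteq> D" for m
    unfolding F_def using meanD by (intro closure_convex_hull_minimal D) auto
  have cl: "closedin weak_topology (F m)" for m
    unfolding F_def by (intro closedin_weak_closed_convex closed_closure convex_closure convex_convex_hull)
  have ne: "F m \<noteq> {}" for m by (simp add: F_def)
  have dec: "decseq F"
    unfolding F_def by (intro decseq_SucI closure_mono hull_mono image_mono) auto
  obtain y where y: "\<And>m. y \<in> F m" using weakly_compact_nest[OF wc cl FD ne dec] by blast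
  have yD: "y \<in> D" using y FD by blast
  have near: "norm (T y - y) \<le> \<epsilon>" if \<epsilon>: "0 < \<epsilon>" for \<epsilon>
  proof -
    obtain N where N: "\<And>n. N \<le> n \<Longrightarrow> norm (cesaro_mean T n (T x) - cesaro_mean T n x) < \<epsilon>"
      using LIMSEQ_D[OF cesaro_mean_shift_tendsto_zero[OF bd T(1) x] \<epsilon>] by auto
    have "cesaro_mean T n x \<in> {z \<in> D. norm (T z - z) \<le> \<epsilon>}" if "Suc N \<le> n" for n
      using meanD[of n] N[of n] that affine_cesaro_mean[OF T(2,1) x D(2), of n] by (simp add: less_imp_le)
    then have "F N \<subseteq> {z \<in> D. norm (T z - z) \<le> \<epsilon>}"
      unfolding F_def by (intro closure_convex_hull_minimal closed_affine_displacement D cont T) auto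
    then show ?thesis using y by blast
  qed
  have "norm (T y - y) \<le> 0" by (rule field_le_epsilon) (use near in simp)
  then have Ty: "T y = y" by simp
  then have "(T ^^ k) y = y" for k by (induction k) auto
  then have fix_y: "cesaro_mean T n y = y" if "1 \<le> n" for n
    using that by (simp add: cesaro_mean_def sum_constant_scaleR)
  \<comment> \<open>\<open>K\<close> is convex and contains the orbit of \<open>x\<close>, since
    replacing a point by its image changes the \<open>n\<close>-th mean by a bounded vector divided
    by \<open>n\<close>. Hence it contains all means, and \<open>y\<close> lies in its norm
    closure.\<close>
  define K where "K = {z \<in> D. (\<lambda>n. cesaro_mean T n z - cesaro_mean T n x) \<longlonglongrightarrow> 0}"
  have "convex K"
    unfolding convex_alt
  proof (intro ballI allI impI)
    fix a b and u :: real assume a: "a \<in> K" and b: "b \<in> K" and u: "0 \<le> u \<and> u \<le> 1"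
    have eq: "cesaro_mean T n ((1 - u) *\<^sub>R a + u *\<^sub>R b) - cesaro_mean T n x
        = (1 - u) *\<^sub>R (cesaro_mean T n a - cesaro_mean T n x) + u *\<^sub>R (cesaro_mean T n b - cesaro_mean T n x)" for n
      using affine_fun_onD[OF affine_fun_on_cesaro_mean[OF T(2,1)], of a b u n] a b u
      by (simp add: K_def algebra_simps)
    have "(\<lambda>n. (1 - u) *\<^sub>R (cesaro_mean T n a - cesaro_mean T n x) + u *\<^sub>R (cesaro_mean T n b - cesaro_mean T n x))
        \<longlonglongrightarrow> (1 - u) *\<^sub>R 0 + u *\<^sub>R 0"
      using a b by (intro tendsto_intros) (auto simp: K_def)
    then show "(1 - u) *\<^sub>R a + u *\<^sub>R b \<in> K"
      using D(2) a b u unfolding K_def convex_alt by (simp add: eq)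
  qed
  have "(T ^^ k) x \<in> K" for k
  proof (induction k)
    case 0
    show ?case using x by (simp add: K_def)
  next
    case (Suc k)
    have "(\<lambda>n. (cesaro_mean T n (T ((T ^^ k) x)) - cesaro_mean T n ((T ^^ k) x)) +
        (cesaro_mean T n ((T ^^ k) x) - cesaro_mean T n x)) \<longlonglongrightarrow> 0 + 0"
      using Suc by (intro tendsto_add cesaro_mean_shift_tendsto_zero[OF bd T(1)]) (auto simp: K_def)
    then show ?case using Suc T(1) by (auto simp: K_def)
  qed
  then have "cesaro_mean T n x \<in> K" if "1 \<le> n" for n
    using \<open>convex K\<close> that by (intro cesaro_mean_in_convex)
  then have "F 0 \<subseteq> closure K"
    unfolding F_def using \<open>convex K\<close> by (intro closure_mono hull_minimal) auto
  then have yK: "y \<in> closure K" using y by blast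
  have "(\<lambda>n. cesaro_mean T n x) \<longlonglongrightarrow> y"
  proof (rule metric_LIMSEQ_I)
    fix \<epsilon> :: real assume \<epsilon>: "0 < \<epsilon>"
    then obtain \<delta> where \<delta>: "0 < \<delta>"
      "\<And>n z. 1 \<le> n \<Longrightarrow> z \<in> D \<Longrightarrow> dist z y < \<delta> \<Longrightarrow> dist (cesaro_mean T n z) (cesaro_mean T n y) < \<epsilon> / 2"
      using cesaro_equicontinuousD[OF eq yD, of "\<epsilon> / 2"] by auto
    obtain z where z: "z \<in> K" "dist z y < \<delta>" using yK \<delta>(1) unfolding closure_approachable by blast
    obtain N where N: "\<And>n. N \<le> n \<Longrightarrow> norm (cesaro_mean T n z - cesaro_mean T n x) < \<epsilon> / 2"
      using LIMSEQ_D[of "\<lambda>n. cesaro_mean T n z - cesaro_mean T n x" 0 "\<epsilon> / 2"] z(1) \<epsilon> by (auto simp: K_def)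
    have "dist (cesaro_mean T n x) y < \<epsilon>" if n: "Suc N \<le> n" for n
    proof -
      have "dist (cesaro_mean T n z) y < \<epsilon> / 2" using \<delta>(2)[of n z] z n fix_y[of n] by (simp add: K_def)
      moreover have "dist (cesaro_mean T n x) (cesaro_mean T n z) < \<epsilon> / 2"
        using N[of n] n by (simp add: dist_norm norm_minus_commute)
      ultimately show ?thesis using dist_triangle_half_l dist_commute by metis
    qed
    then show "\<exists>N. \<forall>n\<ge>N. dist (cesaro_mean T n x) y < \<epsilon>" by blast
  qed
  then show "convergent (\<lambda>n. cesaro_mean T n x)" by (auto simp: convergent_def)
qed

section \<open>Weak compactness and ergodicity\<close>

theorem theorem3p4:
  fixes C :: "'a::banach set"
  assumes "closed C" and "convex C"
  shows "weakly_compact C \<longleftrightarrow>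
         (\<forall>D. D \<subseteq> C \<and> closed D \<and> convex D \<longrightarrow> ergodic_set D)"
proof
  assume "weakly_compact C"
  then show "\<forall>D. D \<subseteq> C \<and> closed D \<and> convex D \<longrightarrow> ergodic_set D"
    using weakly_compact_subset weakly_compact_imp_ergodic_set by blast
next
  assume "\<forall>D. D \<subseteq> C \<and> closed D \<and> convex D \<longrightarrow> ergodic_set D"
  then show "weakly_compact C" by (intro weakly_compact_if_ergodic assms) blast
qed

end
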